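(* Let $K$ be a field, $S=K[x_1,\ldots,x_n]$ the polynomial ring with each $\deg x_i=1$, and let $I\subset S$ be a nonzero proper monomial ideal generated in one degree which satisfies the $x$-condition with respect to a monomial order $<^{\#}$ on $K[\{y_u\}_{u\in G(I)}]$. Let $m=|G(I)|$, write the variables $y_u$ as $y_1,\ldots,y_m$, and let $\operatorname{in}(J_{\mathcal R(I)})$ be the initial ideal of $J_{\mathcal R(I)}$ with respect to $<^{\#}_{lex}$. For $a=(a_1,\ldots,a_m)\in\mathbb N^m$ set $y^a=y_1^{a_1}\cdots y_m^{a_m}$, $|a|=\sum_{i=1}^m a_i$ and $$\rho(a)=|\{i\in\{1,\ldots,n\}: x_iy^a\in\operatorname{in}(J_{\mathcal R(I)})\}|.$$ Let $y^c$ (with $c\in\mathbb N^m$) be the least common multiple of those monomials $y^a$ for which there exists an integer $i$ such that $x_iy^a$ belongs to the minimal monomial generating set $G(\operatorname{in}(J_{\mathcal R(I)}))$. Then (a) $\operatorname{depth}S/I^k\ge n-\max\{\rho(a): |a|=k\}-1$ for all $k\ge1$; (b) $\lim_{k\to\infty}\operatorname{depth}S/I^k\ge n-\rho(c)-1$.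
   Context: $G(L)$ denotes the minimal system of monomial generators of a monomial ideal $L$. The Rees algebra is $\mathcal R(I)=K[x_1,\ldots,x_n,\{ut\}_{u\in G(I)}]\subset S[t]$. Let $A=K[x_1,\ldots,x_n,\{y_u\}_{u\in G(I)}]$ be the polynomial ring in $n+|G(I)|$ variables, and let $J_{\mathcal R(I)}$ be the kernel of the surjective $K$-algebra homomorphism $\pi:A\to\mathcal R(I)$ with $\pi(x_i)=x_i$ and $\pi(y_u)=ut$. Let $<_{lex}$ be the lexicographic order on $S$ induced by $x_1>\cdots>x_n$. Given a monomial order $<^{\#}$ on $K[\{y_u\}_{u\in G(I)}]$, define the monomial order $<^{\#}_{lex}$ on $A$ by: for monomials $x^p,x^q$ in the $x_i$ and $y^{p'},y^{q'}$ in the $y_u$, $x^py^{p'}<^{\#}_{lex}x^qy^{q'}$ if either (i) $y^{p'}<^{\#}y^{q'}$, or (ii) $y^{p'}=y^{q'}$ and $x^p<_{lex}x^q$. Then $I$ satisfies the $x$-condition (with respect to $<^{\#}$) if each element of the reduced Gröbner basis of $J_{\mathcal R(I)}$ with respect to $<^{\#}_{lex}$ is at most linear in $x_1,\ldots,x_n$ (i.e. every monomial occurring in it has total degree at most $1$ in $x_1,\ldots,x_n$). Depth is with respect to $(x_1,\ldots,x_n)$; the function $k\mapsto\operatorname{depth}S/I^k$ is eventually constant (Brodmann), and $\lim_{k\to\infty}$ denotes its eventual value. The least common multiple of the empty set of monomials is $1$. *)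

theory Defs
  imports
    "HOL-Library.Poly_Mapping"
    "HOL-Library.Extended_Nat"
    "HOL-Library.Product_Plus"
    "HOL-Library.Cardinality"
    "HOL-Computational_Algebra.Polynomial"
begin

section \<open>Monomials, polynomials and ideals\<close>

text \<open>
  A polynomial ring over \<open>'k\<close> is the monoid algebra \<open>'t \<Rightarrow>\<^sub>0 'k\<close> of its additive monoid \<open>'t\<close> of
  exponents; \<open>mono_of t\<close> is the monomial with exponent \<open>t\<close>.

  \<^item> \<open>S = K[x_1, \<dots>, x_n]\<close> has exponents \<open>'n \<Rightarrow>\<^sub>0 nat\<close>, where \<open>'n\<close> is a finite linearly ordered type
    with \<open>n\<close> elements.
  \<^item> \<open>A = K[x_1, \<dots>, x_n, y_1, \<dots>, y_m]\<close> has exponents \<open>('n \<Rightarrow>\<^sub>0 nat) \<times> ('m \<Rightarrow>\<^sub>0 nat)\<close>, and \<open>(p, a)\<close>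
    stands for \<open>x^p y^a\<close>.
\<close>

definition mono_of :: "'t \<Rightarrow> 't \<Rightarrow>\<^sub>0 'k::zero_neq_one"
  where "mono_of t = Poly_Mapping.single t 1"

definition evar :: "'v \<Rightarrow> 'v \<Rightarrow>\<^sub>0 nat"
  where "evar v = Poly_Mapping.single v 1"

definition mdeg :: "('v::finite \<Rightarrow>\<^sub>0 nat) \<Rightarrow> nat"
  where "mdeg t = (\<Sum>v\<in>UNIV. Poly_Mapping.lookup t v)"

definition mdvd :: "'t::comm_monoid_add \<Rightarrow> 't \<Rightarrow> bool"
  where "mdvd s t \<longleftrightarrow> (\<exists>r. t = s + r)"

text \<open>In particular the least common multiple of the empty set is the exponent \<open>0\<close> of \<open>1\<close>.\<close>

definition is_mlcm :: "'t::comm_monoid_add \<Rightarrow> 't set \<Rightarrow> bool"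
  where "is_mlcm c B \<longleftrightarrow> (\<forall>b\<in>B. mdvd b c) \<and> (\<forall>d. (\<forall>b\<in>B. mdvd b d) \<longrightarrow> mdvd c d)"

text \<open>The ideal generated by a set: the span in the ring as a module over itself.\<close>

lemma module_times: "module ((*) :: 'a::comm_ring_1 \<Rightarrow> 'a \<Rightarrow> 'a)"
  by unfold_locales (simp_all add: algebra_simps)

abbreviation ideal_gen :: "'a::comm_ring_1 set \<Rightarrow> 'a set"
  where "ideal_gen \<equiv> module.span (*)"

primrec ideal_pow :: "'a::comm_ring_1 set \<Rightarrow> nat \<Rightarrow> 'a set"
  where
    "ideal_pow I 0 = UNIV"
  | "ideal_pow I (Suc k) = ideal_gen {f * g | f g. f \<in> I \<and> g \<in> ideal_pow I k}"

definition monomial_ideal :: "('t::comm_monoid_add \<Rightarrow>\<^sub>0 'k::field) set \<Rightarrow> bool"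
  where "monomial_ideal L \<longleftrightarrow> (\<exists>B. L = ideal_gen (mono_of ` B))"

text \<open>
  Exponents of the minimal system of monomial generators \<open>G(L)\<close>: the monomials of \<open>L\<close> that are
  minimal with respect to divisibility.
\<close>

definition min_gens :: "('t::comm_monoid_add \<Rightarrow>\<^sub>0 'k::field) set \<Rightarrow> 't set"
  where "min_gens L = {t. mono_of t \<in> L \<and> (\<forall>s. mono_of s \<in> L \<longrightarrow> mdvd s t \<longrightarrow> s = t)}"

lemma mono_in_ideal_gen_iff:
  "(mono_of t :: 't::comm_monoid_add \<Rightarrow>\<^sub>0 'k::field) \<in> ideal_gen (mono_of ` B) \<longleftrightarrow> (\<exists>s\<in>B. mdvd s t)"
proof
  interpret M: module "(*) :: ('t \<Rightarrow>\<^sub>0 'k) \<Rightarrow> _" by (rule module_times)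
  let ?T = "{f :: 't \<Rightarrow>\<^sub>0 'k. \<forall>t\<in>Poly_Mapping.keys f. \<exists>s\<in>B. mdvd s t}"
  have "M.subspace ?T"
    unfolding M.subspace_def
  proof (intro conjI ballI allI)
    fix f g :: "'t \<Rightarrow>\<^sub>0 'k" assume "f \<in> ?T" "g \<in> ?T"
    then show "f + g \<in> ?T" using keys_add[of f g] by blast
  next
    fix c f :: "'t \<Rightarrow>\<^sub>0 'k" assume f: "f \<in> ?T"
    show "c * f \<in> ?T"
    proof (clarify)
      fix t assume "t \<in> Poly_Mapping.keys (c * f)"
      then obtain a b where "t = a + b" "b \<in> Poly_Mapping.keys f" using keys_mult[of c f] by blast
      with f obtain s r where "s \<in> B" "b = s + r" by (auto simp: mdvd_def)
      then show "\<exists>s\<in>B. mdvd s t" using \<open>t = a + b\<close>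
        by (auto simp: mdvd_def intro!: bexI[of _ s] exI[of _ "a + r"] simp: ac_simps)
    qed
  qed simp
  moreover have "mono_of ` B \<subseteq> ?T"
    by (force simp: mono_of_def mdvd_def intro: exI[of _ 0])
  ultimately have "ideal_gen (mono_of ` B) \<subseteq> ?T" by (intro M.span_minimal)
  moreover assume "(mono_of t :: 't \<Rightarrow>\<^sub>0 'k) \<in> ideal_gen (mono_of ` B)"
  ultimately show "\<exists>s\<in>B. mdvd s t" by (auto simp: mono_of_def)
next
  interpret M: module "(*) :: ('t \<Rightarrow>\<^sub>0 'k) \<Rightarrow> _" by (rule module_times)
  assume "\<exists>s\<in>B. mdvd s t"
  then obtain s r where "s \<in> B" "t = s + r" by (auto simp: mdvd_def)
  then have "(mono_of t :: 't \<Rightarrow>\<^sub>0 'k) = mono_of r * mono_of s"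
    by (simp add: mono_of_def mult_single add.commute)
  then show "(mono_of t :: 't \<Rightarrow>\<^sub>0 'k) \<in> ideal_gen (mono_of ` B)"
    using \<open>s \<in> B\<close> by (simp add: M.span_base M.span_scale)
qed

text \<open>An irredundant system of monomial generators is \<open>min_gens\<close>.\<close>

lemma min_gens_unique:
  fixes L :: "('t::cancel_comm_monoid_add \<Rightarrow>\<^sub>0 'k::field) set"
  assumes conical: "\<And>a b::'t. a + b = 0 \<Longrightarrow> a = 0"
    and gen: "ideal_gen (mono_of ` B) = L"
    and irredundant: "\<And>C. C \<subset> B \<Longrightarrow> ideal_gen (mono_of ` C) \<noteq> L"
  shows "min_gens L = B"
proof
  interpret M: module "(*) :: ('t \<Rightarrow>\<^sub>0 'k) \<Rightarrow> _" by (rule module_times)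
  have mem: "(mono_of t :: 't \<Rightarrow>\<^sub>0 'k) \<in> L \<longleftrightarrow> (\<exists>s\<in>B. mdvd s t)" for t
    unfolding gen[symmetric] by (rule mono_in_ideal_gen_iff)
  have refl: "mdvd t t" for t :: 't by (auto simp: mdvd_def intro: exI[of _ 0])
  have trans: "mdvd r s \<Longrightarrow> mdvd s t \<Longrightarrow> mdvd r t" for r s t :: 't
    by (auto simp: mdvd_def add.assoc)
  have antisym: "s = t" if st: "mdvd s t" "mdvd t s" for s t :: 't
  proof -
    obtain a b where "t = s + a" "s = t + b" using st by (auto simp: mdvd_def)
    then have "s + (a + b) = s + 0" by (simp add: ac_simps)
    then have "a + b = 0" by (rule add_left_imp_eq)
    then show ?thesis using conical[of a b] \<open>t = s + a\<close> by simp
  qed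
  show "min_gens L \<subseteq> B"
    using mem refl by (fastforce simp: min_gens_def)
  show "B \<subseteq> min_gens L"
  proof
    fix t assume t: "t \<in> B"
    have "s = t" if s: "mono_of s \<in> L" "mdvd s t" for s
    proof (rule ccontr)
      assume "s \<noteq> t"
      obtain r where r: "r \<in> B" "mdvd r s" using s mem by blast
      then have "r \<noteq> t" using antisym s(2) \<open>s \<noteq> t\<close> by blast
      have "mdvd r t" using r s trans by blast
      then have "(mono_of t :: 't \<Rightarrow>\<^sub>0 'k) \<in> ideal_gen (mono_of ` (B - {t}))"
        using r \<open>r \<noteq> t\<close> by (auto simp: mono_in_ideal_gen_iff)
      then have "(mono_of r :: 't \<Rightarrow>\<^sub>0 'k) \<in> ideal_gen (mono_of ` (B - {t}))" if "r \<in> B" for r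
        using that by (cases "r = t") (auto intro: M.span_base)
      then have "mono_of ` B \<subseteq> (ideal_gen (mono_of ` (B - {t})) :: ('t \<Rightarrow>\<^sub>0 'k) set)"
        by blast
      then have "L \<subseteq> ideal_gen (mono_of ` (B - {t}))"
        unfolding gen[symmetric] by (rule M.span_minimal) (rule M.subspace_span)
      moreover have "ideal_gen (mono_of ` (B - {t})) \<subseteq> L"
        unfolding gen[symmetric] by (rule M.span_mono) auto
      ultimately show False using irredundant[of "B - {t}"] t by blast
    qed
    then show "t \<in> min_gens L" using t mem[of t] refl[of t] unfolding min_gens_def by blast
  qed
qed


section \<open>Initial ideals and Groebner bases\<close>

definition monomial_order :: "('t::comm_monoid_add \<Rightarrow> 't \<Rightarrow> bool) \<Rightarrow> bool"
  where "monomial_order lt \<longleftrightarrow>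
    (\<forall>s. \<not> lt s s) \<and> (\<forall>r s t. lt r s \<longrightarrow> lt s t \<longrightarrow> lt r t) \<and>
    (\<forall>s t. s \<noteq> t \<longrightarrow> lt s t \<or> lt t s) \<and>
    (\<forall>t. t \<noteq> 0 \<longrightarrow> lt 0 t) \<and> (\<forall>r s t. lt s t \<longrightarrow> lt (s + r) (t + r))"

definition lead_mon :: "('t \<Rightarrow> 't \<Rightarrow> bool) \<Rightarrow> ('t \<Rightarrow>\<^sub>0 'k::zero) \<Rightarrow> 't"
  where "lead_mon lt f = (THE t. t \<in> Poly_Mapping.keys f \<and> (\<forall>s\<in>Poly_Mapping.keys f. s \<noteq> t \<longrightarrow> lt s t))"

definition initial_ideal ::
    "('t::comm_monoid_add \<Rightarrow> 't \<Rightarrow> bool) \<Rightarrow> ('t \<Rightarrow>\<^sub>0 'k::field) set \<Rightarrow> ('t \<Rightarrow>\<^sub>0 'k) set"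
  where "initial_ideal lt J = ideal_gen {mono_of (lead_mon lt f) | f. f \<in> J \<and> f \<noteq> 0}"

definition groebner_basis ::
    "('t::comm_monoid_add \<Rightarrow> 't \<Rightarrow> bool) \<Rightarrow> ('t \<Rightarrow>\<^sub>0 'k::field) set \<Rightarrow> ('t \<Rightarrow>\<^sub>0 'k) set \<Rightarrow> bool"
  where "groebner_basis lt J B \<longleftrightarrow> finite B \<and> 0 \<notin> B \<and> B \<subseteq> J \<and>
    ideal_gen {mono_of (lead_mon lt g) | g. g \<in> B} = initial_ideal lt J"

definition reduced_groebner_basis ::
    "('t::comm_monoid_add \<Rightarrow> 't \<Rightarrow> bool) \<Rightarrow> ('t \<Rightarrow>\<^sub>0 'k::field) set \<Rightarrow> ('t \<Rightarrow>\<^sub>0 'k) set \<Rightarrow> bool"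
  where "reduced_groebner_basis lt J B \<longleftrightarrow> groebner_basis lt J B \<and>
    (\<forall>g\<in>B. Poly_Mapping.lookup g (lead_mon lt g) = 1) \<and>
    (\<forall>g\<in>B. \<forall>h\<in>B. h \<noteq> g \<longrightarrow> (\<forall>t\<in>Poly_Mapping.keys g. \<not> mdvd (lead_mon lt h) t))"


section \<open>The Rees algebra and the x-condition\<close>

text \<open>
  \<open>u\<close> enumerates the exponents of the monomials in \<open>G(I)\<close>. The kernel of
  \<open>\<pi> : A \<rightarrow> R(I)\<close> is computed in \<open>S[t] \<supseteq> R(I)\<close>; \<open>rees_map u f\<close> evaluates \<open>f\<close> at \<open>x_i\<close> and
  \<open>y_j = u_j t\<close>.
\<close>

definition rees_map ::
    "('m::finite \<Rightarrow> 'n::finite \<Rightarrow>\<^sub>0 nat) \<Rightarrow> (('n \<Rightarrow>\<^sub>0 nat) \<times> ('m \<Rightarrow>\<^sub>0 nat) \<Rightarrow>\<^sub>0 'k::field) \<Rightarrow>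
      (('n \<Rightarrow>\<^sub>0 nat) \<Rightarrow>\<^sub>0 'k) poly"
  where "rees_map u f = (\<Sum>(p, a)\<in>Poly_Mapping.keys f.
    [:Poly_Mapping.single 0 (Poly_Mapping.lookup f (p, a)):] *
    (\<Prod>i\<in>UNIV. [:mono_of (evar i):] ^ Poly_Mapping.lookup p i) *
    (\<Prod>j\<in>UNIV. monom (mono_of (u j)) 1 ^ Poly_Mapping.lookup a j))"

definition rees_kernel ::
    "('m::finite \<Rightarrow> 'n::finite \<Rightarrow>\<^sub>0 nat) \<Rightarrow> (('n \<Rightarrow>\<^sub>0 nat) \<times> ('m \<Rightarrow>\<^sub>0 nat) \<Rightarrow>\<^sub>0 'k::field) set"
  where "rees_kernel u = {f. rees_map u f = 0}"

text \<open>
  On \<open>'n \<Rightarrow>\<^sub>0 nat\<close> the library's \<open><\<close> compares at the least index where two exponents differ, so it is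
  the lexicographic order in which smaller indices are larger variables: \<open>x_1 > \<dots> > x_n\<close>.
\<close>

definition sharp_lex :: "('b \<Rightarrow> 'b \<Rightarrow> bool) \<Rightarrow>
    ('n::linorder \<Rightarrow>\<^sub>0 nat) \<times> 'b \<Rightarrow> ('n \<Rightarrow>\<^sub>0 nat) \<times> 'b \<Rightarrow> bool"
  where "sharp_lex lt = (\<lambda>(p, p') (q, q'). lt p' q' \<or> (p' = q' \<and> p < q))"

text \<open>The reduced Groebner basis exists and is unique, so \<open>\<exists>\<close> only names it.\<close>

definition x_condition :: "(('m \<Rightarrow>\<^sub>0 nat) \<Rightarrow> ('m \<Rightarrow>\<^sub>0 nat) \<Rightarrow> bool) \<Rightarrow>
    (('n::{finite,linorder} \<Rightarrow>\<^sub>0 nat) \<times> ('m \<Rightarrow>\<^sub>0 nat) \<Rightarrow>\<^sub>0 'k::field) set \<Rightarrow> bool"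
  where "x_condition lt J \<longleftrightarrow>
    (\<exists>B. reduced_groebner_basis (sharp_lex lt) J B \<and>
      (\<forall>g\<in>B. \<forall>(p, a)\<in>Poly_Mapping.keys g. mdeg p \<le> 1))"

definition rho :: "(('n::finite \<Rightarrow>\<^sub>0 nat) \<times> ('m \<Rightarrow>\<^sub>0 nat) \<Rightarrow>\<^sub>0 'k::field) set \<Rightarrow> ('m \<Rightarrow>\<^sub>0 nat) \<Rightarrow> nat"
  where "rho inJ a = card {i. mono_of (evar i, a) \<in> inJ}"


section \<open>Depth\<close>

text \<open>
  \<open>fs\<close> is a regular sequence on \<open>M = S/J\<close>: each \<open>f_i\<close> is a nonzerodivisor on
  \<open>M/(f_1, \<dots>, f_{i-1})M = S/(J + (f_1, \<dots>, f_{i-1}))\<close>, and \<open>M/(f_1, \<dots>, f_r)M \<noteq> 0\<close>.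
\<close>

definition regular_seq_quot :: "'a::comm_ring_1 set \<Rightarrow> 'a list \<Rightarrow> bool"
  where "regular_seq_quot J fs \<longleftrightarrow>
    (\<forall>i<length fs. \<forall>g. fs ! i * g \<in> ideal_gen (J \<union> set (take i fs)) \<longrightarrow>
      g \<in> ideal_gen (J \<union> set (take i fs))) \<and>
    ideal_gen (J \<union> set fs) \<noteq> UNIV"

text \<open>\<open>depth_quot J\<close> is the depth of \<open>S/J\<close> with respect to \<open>(x_1, \<dots>, x_n)\<close>.\<close>

definition max_ideal :: "(('n \<Rightarrow>\<^sub>0 nat) \<Rightarrow>\<^sub>0 'k::field) set"
  where "max_ideal = ideal_gen (range (\<lambda>i. mono_of (evar i)))"

definition depth_quot :: "(('n \<Rightarrow>\<^sub>0 nat) \<Rightarrow>\<^sub>0 'k::field) set \<Rightarrow> enat"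
  where "depth_quot J =
    (SUP fs \<in> {fs. set fs \<subseteq> max_ideal \<and> regular_seq_quot J fs}. enat (length fs))"

end

theory Submission
  imports Defs "HOL-Library.Set_Algebras"
begin

text \<open>
  Adding the generators \<open>u^a\<close> of \<open>I^k\<close> in the order of the \<open>y^a\<close> gives colon ideals
  \<open>{x^p. x^p y^a \<in> in(J)}\<close>, which the x-condition forces to be generated by \<open>\<rho>(a)\<close> variables or
  to be the whole ring. So \<open>I^k\<close> is filtered by polynomial rings in at least \<open>n - r\<close> variables,
  where \<open>r\<close> bounds the \<open>\<rho>(a)\<close>, and on each of them the elementary symmetric polynomials
  \<open>e_1, \<dots>, e_{n-r}\<close> form a regular sequence, over any field. Hence they are regular on \<open>I^k\<close>.

  Passing to \<open>S/I^k\<close> costs one element and no prime avoidance: some power of \<open>e_{s+1}\<close> lies in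
  \<open>I' = I^k + (monomials with more than s large exponents)\<close>, and \<open>e_1, \<dots>, e_{s+1}\<close> is regular on
  both \<open>I^k\<close> and \<open>I'/I^k\<close>; this makes \<open>I^k/(e_1, \<dots>, e_s)I^k \<rightarrow> S/(e_1, \<dots>, e_s)\<close> injective, so that
  \<open>e_1, \<dots>, e_{n-r-1}\<close> is regular on \<open>S/I^k\<close>. For (b), \<open>\<rho>(a) \<le> \<rho>(c)\<close> for every \<open>y^a \<notin> in(J)\<close>.
\<close>


section \<open>Weakly regular sequences\<close>

interpretation ideals: module "(*) :: 'a::comm_ring_1 \<Rightarrow> 'a \<Rightarrow> 'a"
  by (rule module_times)

declare ideals.scale_scale [simp del] \<comment> \<open>reassociates products to the left, so loops with \<open>ac_simps\<close>\<close>

abbreviation is_ideal :: "'a::comm_ring_1 set \<Rightarrow> bool"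
  where "is_ideal \<equiv> module.subspace (*)"

section \<open>Arithmetic of ideals as sets\<close>

lemma ideal_mult_right: "is_ideal A \<Longrightarrow> x \<in> A \<Longrightarrow> x * c \<in> A"
  by (metis ideals.subspace_scale mult.commute)

lemma is_ideal_UNIV: "is_ideal UNIV"
  by (simp add: ideals.subspace_UNIV)

lemma is_ideal_set_zero: "is_ideal (0 :: 'a::comm_ring_1 set)"
  by (simp add: set_zero ideals.subspace_single_0)

lemma is_ideal_set_plus: "is_ideal A \<Longrightarrow> is_ideal B \<Longrightarrow> is_ideal (A + B)"
  unfolding ideals.subspace_def set_plus_def
  by (safe; metis add.right_neutral add.assoc add.left_commute distrib_left)

lemma is_ideal_elt_set_times: "is_ideal A \<Longrightarrow> is_ideal (f *o A)"
  unfolding ideals.subspace_def elt_set_times_def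
  by (safe; metis mult_zero_right distrib_left mult.left_commute)

lemma ideal_absorb: "is_ideal A \<Longrightarrow> B \<subseteq> A \<Longrightarrow> is_ideal B \<Longrightarrow> A + B = A"
  using ideals.subspace_add[of A] set_zero_plus2[of B A] ideals.subspace_0[of B]
  by (auto simp: add.commute elim!: set_plus_elim)

lemma elt_set_times_subset: "is_ideal A \<Longrightarrow> f *o A \<subseteq> A"
  by (auto simp: elt_set_times_def intro: ideals.subspace_scale)

lemma set_plus_subset_ideal: "is_ideal A \<Longrightarrow> B \<subseteq> A \<Longrightarrow> C \<subseteq> A \<Longrightarrow> B + C \<subseteq> A"
  by (auto elim!: set_plus_elim intro: ideals.subspace_add)

lemma subset_set_plus1: "is_ideal B \<Longrightarrow> A \<subseteq> A + B"
  by (metis ideals.subspace_0 set_zero_plus2 add.commute)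

lemma subset_set_plus2: "is_ideal A \<Longrightarrow> B \<subseteq> A + B"
  by (simp add: ideals.subspace_0 set_zero_plus2)

lemma set_plus_elt_times_cases:
  assumes "x \<in> B + f *o A"
  obtains b a where "x = b + f * a" "b \<in> B" "a \<in> A"
  using assms by (force simp: elt_set_times_def set_plus_def)

text \<open>The coefficient ideal A is a parameter so that (fs) A can be compared with (fs) B for A
  inside B, in particular with the ideal generated by \<open>fs\<close> in the whole ring.\<close>

primrec gen_by :: "'a::comm_ring_1 set \<Rightarrow> 'a list \<Rightarrow> 'a set"
  where
    "gen_by A [] = 0"
  | "gen_by A (f # fs) = f *o A + gen_by A fs"

text \<open>\<open>rseq A B fs\<close> is weak regularity on the module \<open>A/B\<close>: the condition \<open>M/(f_1, \<dots>, f_r)M \<noteq> 0\<close> is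
  not part of it, so that \<open>A = B\<close> is allowed.\<close>

primrec rseq :: "'a::comm_ring_1 set \<Rightarrow> 'a set \<Rightarrow> 'a list \<Rightarrow> bool"
  where
    "rseq A B [] \<longleftrightarrow> True"
  | "rseq A B (f # fs) \<longleftrightarrow> (\<forall>g\<in>A. f * g \<in> B \<longrightarrow> g \<in> B) \<and> rseq A (B + f *o A) fs"

section \<open>Weak regularity along subquotients and exact sequences\<close>

lemma gen_by_append: "gen_by A (fs @ gs) = gen_by A fs + gen_by A gs"
  by (induction fs) (simp_all add: add.assoc)

lemma rseq_append: "rseq A B (fs @ gs) \<longleftrightarrow> rseq A B fs \<and> rseq A (B + gen_by A fs) gs"
  by (induction fs arbitrary: B) (simp_all add: add.assoc)

lemma is_ideal_gen_by: "is_ideal A \<Longrightarrow> is_ideal (gen_by A fs)"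
  by (induction fs) (auto intro: is_ideal_set_zero is_ideal_set_plus is_ideal_elt_set_times)

lemma gen_by_subset: "is_ideal A \<Longrightarrow> gen_by A fs \<subseteq> A"
  by (induction fs)
    (simp_all add: set_zero ideals.subspace_0 set_plus_subset_ideal elt_set_times_subset)

text \<open>Taking w = 1 gives monotonicity in A; taking for w a power that lies in an ideal B moves
  the ideal generated by \<open>fs\<close> into (fs) B.\<close>

lemma gen_by_mult: "w *o A \<subseteq> B \<Longrightarrow> h \<in> gen_by A fs \<Longrightarrow> w * h \<in> gen_by B fs"
proof (induction fs arbitrary: h)
  case (Cons f fs)
  obtain a y where h: "h = f * a + y" "a \<in> A" "y \<in> gen_by A fs"
    using Cons.prems(2) set_plus_elt_times_cases[of h "gen_by A fs" f A]
    by (metis add.commute gen_by.simps(2))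
  have "w * h = f * (w * a) + w * y" unfolding h(1) by (simp only: distrib_left mult.left_commute)
  moreover have "w * a \<in> B" using set_times_intro2[OF h(2)] Cons.prems(1) by (rule subsetD[rotated])
  moreover have "w * y \<in> gen_by B fs" using Cons.IH Cons.prems(1) h(3) by blast
  ultimately show ?case by (simp add: set_plus_intro set_times_intro2)
qed (simp add: set_zero)

lemma gen_by_mono: "A \<subseteq> B \<Longrightarrow> gen_by A fs \<subseteq> gen_by B fs"
  using gen_by_mult[of 1 A B] by auto

text \<open>All contributions f C are absorbed by the summand C.\<close>

lemma gen_by_plus:
  assumes "is_ideal C"
  shows "gen_by (A + C) fs + C = gen_by A fs + C"
proof (induction fs)
  case (Cons f fs)
  have "f *o (A + C) + gen_by (A + C) fs + C = f *o A + (f *o C + C) + gen_by (A + C) fs"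
    by (simp add: set_times_plus_distrib2 ac_simps)
  also have "f *o C + C = C"
    using ideal_absorb[OF assms elt_set_times_subset[OF assms] is_ideal_elt_set_times[OF assms]]
    by (simp add: add.commute)
  also have "f *o A + C + gen_by (A + C) fs = f *o A + (gen_by (A + C) fs + C)"
    by (simp only: ac_simps)
  finally show ?case by (simp add: Cons add.assoc)
qed simp

text \<open>The one-element case of the Tor vanishing below: for f regular on D/A, a product f d
  that falls into A has its factor d in A.\<close>

lemma elt_set_times_Int:
  assumes "is_ideal B" "B \<subseteq> A" "\<And>g. g \<in> D \<Longrightarrow> f * g \<in> A \<Longrightarrow> g \<in> A"
  shows "A \<inter> f *o D \<subseteq> f *o A"
  using assms by (auto simp: elt_set_times_def)

text \<open>The second isomorphism theorem: \<open>A/B\<close> maps onto \<open>(A + C)/(B + C)\<close>, injectively if \<open>A \<inter> C \<subseteq> B\<close>.\<close>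

lemma rseq_plus:
  assumes "is_ideal A" "is_ideal C"
  shows "is_ideal B \<Longrightarrow> B \<subseteq> A \<Longrightarrow> A \<inter> C \<subseteq> B \<Longrightarrow> rseq A B fs \<Longrightarrow> rseq (A + C) (B + C) fs"
proof (induction fs arbitrary: B)
  case (Cons f fs)
  let ?B = "B + f *o A"
  have fA: "is_ideal (f *o A)" "f *o A \<subseteq> A"
    using assms by (simp_all add: is_ideal_elt_set_times elt_set_times_subset)
  have "g \<in> B + C" if mem: "g \<in> A + C" "f * g \<in> B + C" for g
  proof -
    obtain a c where g: "g = a + c" "a \<in> A" "c \<in> C" using mem(1) by (rule set_plus_elim)
    obtain b d where fg: "f * g = b + d" "b \<in> B" "d \<in> C" using mem(2) by (rule set_plus_elim)
    \<comment> \<open>The common value lies in A by the left side and in C by the right side, hence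
      in B.\<close>
    have eq: "f * a - b = d - f * c" using fg(1) unfolding g(1) by (simp add: algebra_simps)
    have "f * a - b \<in> A" using g(2) fg(2) Cons.prems(2) assms(1)
      by (meson ideals.subspace_diff ideals.subspace_scale subsetD)
    moreover have "f * a - b \<in> C" unfolding eq using g(3) fg(3) assms(2)
      by (meson ideals.subspace_diff ideals.subspace_scale)
    ultimately have "f * a - b \<in> B" using Cons.prems(3) by (meson IntI subsetD)
    then have "f * a \<in> B" using ideals.subspace_add[OF Cons.prems(1) _ fg(2)] by force
    then have "a \<in> B" using Cons.prems(4) g(2) by simp
    then show ?thesis unfolding g(1) using g(3) by (rule set_plus_intro)
  qed
  moreover have "rseq (A + C) (?B + C) fs"
  proof (rule Cons.IH)
    show "is_ideal ?B" using Cons.prems(1) fA(1) by (rule is_ideal_set_plus)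
    show "?B \<subseteq> A" using assms(1) Cons.prems(2) fA(2) by (rule set_plus_subset_ideal)
    show "A \<inter> C \<subseteq> ?B" using Cons.prems(3) subset_set_plus1[OF fA(1)] by (rule subset_trans)
    show "rseq A ?B fs" using Cons.prems(4) by simp
  qed
  moreover have "B + C + f *o (A + C) = ?B + C"
  proof -
    have "f *o C + C = C"
      using ideal_absorb[OF assms(2) elt_set_times_subset is_ideal_elt_set_times] assms(2)
      by (metis add.commute)
    then show ?thesis by (metis (no_types, opaque_lifting) add.assoc add.commute set_times_plus_distrib2)
  qed
  ultimately show ?case by simp
qed simp

text \<open>Regularity passes to the middle of 0 -> A/B -> D/B -> D/A -> 0. As f is regular on D/A,
  the sequence stays exact modulo f, and \<open>rseq_plus\<close> identifies A/(B + f A) with (A + f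
  D)/(B + f D), to which the induction applies.\<close>

lemma rseq_extension:
  assumes "is_ideal D"
  shows "is_ideal A \<Longrightarrow> is_ideal B \<Longrightarrow> B \<subseteq> A \<Longrightarrow> A \<subseteq> D \<Longrightarrow> rseq A B fs \<Longrightarrow> rseq D A fs \<Longrightarrow> rseq D B fs"
proof (induction fs arbitrary: A B)
  case (Cons f fs)
  let ?C = "f *o D"
  have C: "is_ideal ?C" "?C \<subseteq> D" and fA: "is_ideal (f *o A)" "f *o A \<subseteq> A"
    using assms Cons.prems by (simp_all add: is_ideal_elt_set_times elt_set_times_subset)
  have int: "A \<inter> ?C \<subseteq> f *o A"
    using Cons.prems(2,3,6) by (intro elt_set_times_Int[of B]) simp_all
  have "?C + f *o A = ?C"
    using C(1) set_times_mono[OF Cons.prems(4)] fA(1) by (rule ideal_absorb)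
  then have BC: "B + f *o A + ?C = B + ?C" by (metis add.assoc add.commute)
  have "rseq (A + ?C) (B + f *o A + ?C) fs"
  proof (rule rseq_plus[OF Cons.prems(1) C(1)])
    show "is_ideal (B + f *o A)" using Cons.prems(2) fA(1) by (rule is_ideal_set_plus)
    show "B + f *o A \<subseteq> A" using Cons.prems(1,3) fA(2) by (rule set_plus_subset_ideal)
    show "A \<inter> ?C \<subseteq> B + f *o A"
      using int subset_set_plus2[OF Cons.prems(2)] by (rule subset_trans)
    show "rseq A (B + f *o A) fs" using Cons.prems(5) by simp
  qed
  then have "rseq (A + ?C) (B + ?C) fs" by (simp only: BC)
  moreover have "rseq D (A + ?C) fs" using Cons.prems(6) by simp
  moreover have "A + ?C \<subseteq> D" using assms Cons.prems(4) C(2) by (rule set_plus_subset_ideal)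
  moreover have "B + ?C \<subseteq> A + ?C" using Cons.prems(3) by (rule set_plus_mono2) simp
  ultimately have "rseq D (B + ?C) fs"
    using Cons.IH is_ideal_set_plus[OF _ C(1)] Cons.prems(1,2) by metis
  moreover have "\<forall>g\<in>D. f * g \<in> B \<longrightarrow> g \<in> B"
    using Cons.prems(3,4,5,6) by (meson rseq.simps(2) subsetD)
  ultimately show ?case by simp
qed simp

text \<open>The vanishing of \<open>Tor_1(D/A, R/(fs))\<close>, for \<open>fs\<close> regular on \<open>D/A\<close>.\<close>

lemma rseq_gen_by_Int:
  assumes "is_ideal D"
  shows "is_ideal A \<Longrightarrow> A \<subseteq> D \<Longrightarrow> rseq D A fs \<Longrightarrow> A \<inter> gen_by D fs \<subseteq> gen_by A fs"
proof (induction fs arbitrary: A)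
  case (Cons f fs)
  let ?C = "f *o D"
  have C: "is_ideal ?C" "?C \<subseteq> D"
    using assms by (simp_all add: is_ideal_elt_set_times elt_set_times_subset)
  have int: "A \<inter> ?C \<subseteq> f *o A"
    using Cons.prems by (intro elt_set_times_Int[of A]) simp_all
  have AC: "(A + ?C) \<inter> gen_by D fs \<subseteq> gen_by (A + ?C) fs"
    using Cons.IH[OF is_ideal_set_plus[OF Cons.prems(1) C(1)]
        set_plus_subset_ideal[OF assms Cons.prems(2) C(2)]] Cons.prems(3) by simp
  show ?case
  proof
    fix h assume "h \<in> A \<inter> gen_by D (f # fs)"
    then have h: "h \<in> A" "h \<in> ?C + gen_by D fs" by simp_all
    obtain x y where xy: "h = x + y" "x \<in> ?C" "y \<in> gen_by D fs" using h(2) by (rule set_plus_elim)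
    have "y = h + (- x)" using xy by simp
    then have "y \<in> A + ?C"
      using set_plus_intro[OF h(1) ideals.subspace_neg[OF C(1) xy(2)]] by simp
    then have "y \<in> gen_by (A + ?C) fs" using AC xy(3) by (meson IntI subsetD)
    then have "h \<in> gen_by (A + ?C) fs + ?C" using xy by (metis add.commute set_plus_intro)
    then have "h \<in> gen_by A fs + ?C" by (simp only: gen_by_plus[OF C(1)])
    then obtain v w where vw: "h = v + w" "v \<in> gen_by A fs" "w \<in> ?C" by (rule set_plus_elim)
    have "v \<in> A" using vw(2) gen_by_subset[OF Cons.prems(1)] by (rule subsetD[rotated])
    \<comment> \<open>The remainder w lies in A and in f D, hence in f A, because f is regular on
      D/A.\<close>
    have "w = h - v" using vw by simp
    then have "w \<in> A" using ideals.subspace_diff[OF Cons.prems(1) h(1) \<open>v \<in> A\<close>] by simp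
    then have "w \<in> f *o A" using int vw(3) by (meson IntI subsetD)
    then show "h \<in> gen_by A (f # fs)" using vw by (metis add.commute gen_by.simps(2) set_plus_intro)
  qed
qed (auto simp: set_zero)

text \<open>Multiplication by a nonzerodivisor u is an isomorphism from A/B to u A/u B.\<close>

lemma rseq_elt_set_times:
  assumes "\<And>x y. u * x = u * y \<Longrightarrow> x = y"
  shows "rseq A B fs \<Longrightarrow> rseq (u *o A) (u *o B) fs"
proof (induction fs arbitrary: B)
  case (Cons f fs)
  have "f *o (u *o A) = u *o (f *o A)" by (simp add: set_times_rearrange2 mult.commute)
  then have "u *o B + f *o (u *o A) = u *o (B + f *o A)" by (simp add: set_times_plus_distrib2)
  moreover have "g \<in> u *o B" if g: "g \<in> u *o A" "f * g \<in> u *o B" for g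
  proof -
    obtain a b where ab: "g = u * a" "a \<in> A" "f * g = u * b" "b \<in> B"
      using g by (auto simp: elt_set_times_def)
    then have "f * a = b" using assms[of "f * a" b] by (simp add: ac_simps)
    then show ?thesis using ab Cons.prems by auto
  qed
  ultimately show ?case using Cons by simp
qed simp

text \<open>Q is the colon ideal L : u, and (L + (u))/L is isomorphic to R/Q through multiplication
  by u.\<close>

lemma rseq_colon:
  assumes L: "is_ideal L" and Q: "is_ideal Q" and colon: "\<And>g. u * g \<in> L \<longleftrightarrow> g \<in> Q"
    and u: "\<And>x y. u * x = u * y \<Longrightarrow> x = y" and reg: "rseq UNIV Q fs"
  shows "rseq (L + u *o UNIV) L fs"
proof -
  have "u *o Q \<subseteq> L" using colon by (auto simp: elt_set_times_def)
  then have "u *o Q + L = L" using L Q ideal_absorb is_ideal_elt_set_times by (metis add.commute)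
  moreover have "rseq (u *o UNIV + L) (u *o Q + L) fs"
    using L Q rseq_elt_set_times[OF u reg] colon
    by (intro rseq_plus is_ideal_elt_set_times is_ideal_UNIV) (auto simp: elt_set_times_def)
  ultimately show ?thesis by (simp add: add.commute)
qed

text \<open>Exchanging \<open>z, fs\<close> for \<open>fs, z\<close>; this direction needs no Nakayama argument.\<close>

lemma regular_after_rseq:
  assumes A: "is_ideal A"
  shows "is_ideal B \<Longrightarrow> B \<subseteq> A \<Longrightarrow> \<forall>g\<in>A. z * g \<in> B \<longrightarrow> g \<in> B \<Longrightarrow> rseq A (B + z *o A) fs \<Longrightarrow>
    \<forall>g\<in>A. z * g \<in> B + gen_by A fs \<longrightarrow> g \<in> B + gen_by A fs"
proof (induction fs arbitrary: B)
  case (Cons f fs)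
  have zA: "is_ideal (z *o A)" and fA: "is_ideal (f *o A)" "f *o A \<subseteq> A"
    using A by (simp_all add: is_ideal_elt_set_times elt_set_times_subset)
  have "g \<in> B + f *o A" if g: "g \<in> A" "z * g \<in> B + f *o A" for g
  proof -
    obtain b a where ba: "z * g = b + f * a" "b \<in> B" "a \<in> A"
      using g(2) by (rule set_plus_elt_times_cases)
    have "f * a = (- b) + z * g" using ba by simp
    then have "f * a \<in> B + z *o A"
      using set_plus_intro[OF ideals.subspace_neg[OF Cons.prems(1) ba(2)] set_times_intro2[OF g(1)]]
      by simp
    then have "a \<in> B + z *o A" using Cons.prems(4) ba(3) by simp
    then obtain b' a' where b'a': "a = b' + z * a'" "b' \<in> B" "a' \<in> A"
      by (rule set_plus_elt_times_cases)
    \<comment> \<open>Substituting a = b' + z a' moves the multiple of z to the left, so that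
      regularity of z modulo B applies to g - f a'.\<close>
    have "z * (g - f * a') = b + f * b'" using ba(1) unfolding b'a'(1) by (simp add: algebra_simps)
    also have "\<dots> \<in> B" using ba b'a' Cons.prems ideals.subspace_add ideals.subspace_scale by blast
    finally have "g - f * a' \<in> B"
      using Cons.prems g b'a' A ideals.subspace_diff ideals.subspace_scale by blast
    then have "(g - f * a') + f * a' \<in> B + f *o A"
      using set_times_intro2[OF b'a'(3)] by (rule set_plus_intro)
    then show ?thesis by simp
  qed
  moreover have "rseq A (B + f *o A + z *o A) fs"
    using Cons.prems by (simp add: ac_simps)
  ultimately have "\<forall>g\<in>A. z * g \<in> B + f *o A + gen_by A fs \<longrightarrow> g \<in> B + f *o A + gen_by A fs"
    using Cons.prems A fA by (intro Cons.IH is_ideal_set_plus set_plus_subset_ideal) simp_all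
  then show ?case by (simp add: add.assoc)
qed simp

text \<open>If \<open>w\<close> is nilpotent on \<open>R/I'\<close>, then it is nilpotent on the kernel \<open>(I' \<inter> (fs)) / (fs) I'\<close> of
  \<open>I'/(fs) I' \<rightarrow> R/(fs)\<close>; since it is also a nonzerodivisor on \<open>I'/(fs) I'\<close>, this kernel vanishes.\<close>

lemma gen_by_UNIV_Int:
  assumes I: "is_ideal I" "is_ideal I'" "I \<subseteq> I'"
    and quot: "rseq I' I (fs @ [w])" and reg: "rseq I 0 (fs @ [w])" and w: "w ^ k \<in> I'"
  shows "I \<inter> gen_by UNIV fs \<subseteq> gen_by I fs"
proof
  fix h assume h: "h \<in> I \<inter> gen_by UNIV fs"
  \<comment> \<open>I' is an extension of I'/I by I, and the sequence is regular on both.\<close>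
  have "rseq I' 0 (fs @ [w])"
    using rseq_extension[OF I(2) I(1) is_ideal_set_zero _ I(3) reg quot] I(1)
    by (simp add: set_zero ideals.subspace_0)
  then have nzd: "g \<in> I' \<Longrightarrow> w * g \<in> gen_by I' fs \<Longrightarrow> g \<in> gen_by I' fs" for g
    by (simp add: rseq_append)
  have cancel: "g \<in> I' \<Longrightarrow> w ^ j * g \<in> gen_by I' fs \<Longrightarrow> g \<in> gen_by I' fs" for g j
  proof (induction j)
    case (Suc j)
    then have "w * (w ^ j * g) \<in> gen_by I' fs" by (simp add: mult.assoc)
    moreover have "w ^ j * g \<in> I'" using I(2) Suc.prems(1) by (rule ideals.subspace_scale)
    ultimately show ?case using nzd Suc.IH Suc.prems(1) by blast
  qed simp
  have "w ^ k *o UNIV \<subseteq> I'" using w I by (auto simp: elt_set_times_def intro: ideal_mult_right)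
  then have "w ^ k * h \<in> gen_by I' fs" using h by (meson IntD2 gen_by_mult)
  then have "h \<in> gen_by I' fs" using cancel h I by blast
  \<comment> \<open>Regularity of \<open>fs\<close> on I'/I now brings h from (fs) I' down to (fs)
    I.\<close>
  moreover have "rseq I' I fs" using quot by (simp add: rseq_append)
  ultimately show "h \<in> gen_by I fs" using rseq_gen_by_Int[OF I(2) I(1,3)] h gen_by_mono by blast
qed

section \<open>Generated ideals in the form used by regular sequences\<close>

lemma ideal_gen_Un: "ideal_gen (A \<union> B) = ideal_gen A + ideal_gen B"
  by (auto simp: ideals.span_Un set_plus_def)

lemma ideal_gen_set: "ideal_gen (set fs) = gen_by UNIV fs"
proof (induction fs)
  case (Cons f fs)
  have "ideal_gen {f} = f *o UNIV"
    by (auto simp: ideals.span_singleton elt_set_times_def mult.commute)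
  then show ?case using Cons ideal_gen_Un[of "{f}" "set fs"] by simp
qed (simp add: set_zero)

lemma ideal_gen_ideal_Un: "is_ideal I \<Longrightarrow> ideal_gen (I \<union> set fs) = I + gen_by UNIV fs"
  by (metis ideal_gen_Un ideal_gen_set ideals.span_eq_iff)


section \<open>Monomial ideals and truncation\<close>

text \<open>Monomial ideals are treated as linear spans of exponent sets closed under multiples:
  sums, inclusions and colons by monomials become set operations on exponents.\<close>

definition mon_span :: "'t set \<Rightarrow> ('t \<Rightarrow>\<^sub>0 'k::zero) set"
  where "mon_span T = {f. Poly_Mapping.keys f \<subseteq> T}"

definition mult_closed :: "'t::plus set \<Rightarrow> bool"
  where "mult_closed T \<longleftrightarrow> (\<forall>t\<in>T. \<forall>r. t + r \<in> T)"

definition restr :: "'t set \<Rightarrow> ('t \<Rightarrow>\<^sub>0 'k::comm_monoid_add) \<Rightarrow> 't \<Rightarrow>\<^sub>0 'k"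
  where "restr T f = (\<Sum>t\<in>Poly_Mapping.keys f \<inter> T. Poly_Mapping.single t (Poly_Mapping.lookup f t))"

lemma lookup_restr:
  "Poly_Mapping.lookup (restr T f) t = (if t \<in> T then Poly_Mapping.lookup f t else 0)"
  by (auto simp: restr_def lookup_sum lookup_single when_def in_keys_iff if_distrib sum.delta
      cong: if_cong)

lemma restr_UNIV: "restr UNIV f = f"
  by (rule poly_mapping_eqI) (simp add: lookup_restr)

lemma restr_add: "restr T (f + g) = restr T f + restr T g"
  by (rule poly_mapping_eqI) (simp add: lookup_restr lookup_add)

lemma restr_split: "f = restr T f + restr (- T) f"
  by (rule poly_mapping_eqI) (simp add: lookup_restr lookup_add)

lemma keys_restr: "Poly_Mapping.keys (restr T f) = Poly_Mapping.keys f \<inter> T"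
  by (auto simp: in_keys_iff lookup_restr split: if_splits)

lemma restr_eq_self: "Poly_Mapping.keys f \<subseteq> T \<Longrightarrow> restr T f = f"
  by (rule poly_mapping_eqI) (auto simp: lookup_restr in_keys_iff)

lemma restr_eq_0: "Poly_Mapping.keys f \<inter> T = {} \<Longrightarrow> restr T f = 0"
  by (rule poly_mapping_eqI) (auto simp: lookup_restr in_keys_iff)

lemma is_ideal_mon_span:
  "mult_closed T \<Longrightarrow> is_ideal (mon_span T :: ('t::comm_monoid_add \<Rightarrow>\<^sub>0 'k::comm_ring_1) set)"
proof -
  assume T: "mult_closed T"
  have "c * f \<in> mon_span T" if f: "f \<in> mon_span T" for c f :: "'t \<Rightarrow>\<^sub>0 'k"
  proof -
    have "t \<in> T" if t: "t \<in> Poly_Mapping.keys (c * f)" for t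
    proof -
      obtain a b where "t = a + b" "b \<in> Poly_Mapping.keys f" using t keys_mult[of c f] by blast
      then show ?thesis using f T add.commute[of a b] by (auto simp: mon_span_def mult_closed_def)
    qed
    then show ?thesis by (auto simp: mon_span_def)
  qed
  moreover have "f + g \<in> mon_span T" if "f \<in> mon_span T" "g \<in> mon_span T" for f g :: "'t \<Rightarrow>\<^sub>0 'k"
    using that keys_add[of f g] by (auto simp: mon_span_def)
  ultimately show ?thesis by (simp add: ideals.subspace_def mon_span_def)
qed

lemma mono_of_in_mon_span [simp]:
  "(mono_of t :: 't \<Rightarrow>\<^sub>0 'k::zero_neq_one) \<in> mon_span T \<longleftrightarrow> t \<in> T"
  by (simp add: mon_span_def mono_of_def)

lemma mono_of_add: "(mono_of (s + t) :: 't::comm_monoid_add \<Rightarrow>\<^sub>0 'k::comm_ring_1) = mono_of s * mono_of t"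
  by (simp add: mono_of_def mult_single)

lemma mon_span_subset:
  assumes A: "is_ideal A" and T: "\<And>t. t \<in> T \<Longrightarrow> mono_of t \<in> A"
  shows "mon_span T \<subseteq> (A :: ('t::comm_monoid_add \<Rightarrow>\<^sub>0 'k::comm_ring_1) set)"
proof
  fix f :: "'t \<Rightarrow>\<^sub>0 'k" assume f: "f \<in> mon_span T"
  have "restr T f \<in> A" unfolding restr_def
  proof (rule ideals.subspace_sum[OF A])
    fix t assume t: "t \<in> Poly_Mapping.keys f \<inter> T"
    have "Poly_Mapping.single t (Poly_Mapping.lookup f t) =
        Poly_Mapping.single 0 (Poly_Mapping.lookup f t) * mono_of t"
      by (simp add: mono_of_def mult_single)
    then show "Poly_Mapping.single t (Poly_Mapping.lookup f t) \<in> A"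
      using T t ideals.subspace_scale[OF A] by simp
  qed
  then show "f \<in> A" using f restr_eq_self[of f T] by (simp add: mon_span_def)
qed

lemma mon_span_Un: "mon_span (T \<union> U) = mon_span T + (mon_span U :: ('t \<Rightarrow>\<^sub>0 'k::comm_ring_1) set)"
proof
  show "mon_span (T \<union> U) \<subseteq> mon_span T + (mon_span U :: ('t \<Rightarrow>\<^sub>0 'k) set)"
  proof
    fix f :: "'t \<Rightarrow>\<^sub>0 'k" assume "f \<in> mon_span (T \<union> U)"
    then have "restr T f \<in> mon_span T" "restr (- T) f \<in> mon_span U"
      by (auto simp: mon_span_def keys_restr)
    then show "f \<in> mon_span T + mon_span U" using restr_split[of f T] by (metis set_plus_intro)
  qed
  show "mon_span T + mon_span U \<subseteq> (mon_span (T \<union> U) :: ('t \<Rightarrow>\<^sub>0 'k) set)"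
  proof
    fix f :: "'t \<Rightarrow>\<^sub>0 'k" assume "f \<in> mon_span T + mon_span U"
    then obtain g h where "f = g + h" "g \<in> mon_span T" "h \<in> mon_span U" by (rule set_plus_elim)
    then show "f \<in> mon_span (T \<union> U)" using keys_add[of g h] by (auto simp: mon_span_def)
  qed
qed

lemma mult_closed_multiples: "mult_closed (range ((+) (t :: 't::ab_semigroup_add)))"
  by (auto simp: mult_closed_def add.assoc)

lemma mult_closed_Un: "mult_closed T \<Longrightarrow> mult_closed U \<Longrightarrow> mult_closed (T \<union> U)"
  by (auto simp: mult_closed_def)

lemma mono_of_times_UNIV:
  "(mono_of t :: 't::comm_monoid_add \<Rightarrow>\<^sub>0 'k::comm_ring_1) *o UNIV = mon_span (range ((+) t))"
proof
  have "(mono_of t :: 't \<Rightarrow>\<^sub>0 'k) \<in> mon_span (range ((+) t))"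
    by (metis add.right_neutral mono_of_in_mon_span rangeI)
  then show "(mono_of t :: 't \<Rightarrow>\<^sub>0 'k) *o UNIV \<subseteq> mon_span (range ((+) t))"
    using ideal_mult_right[OF is_ideal_mon_span[OF mult_closed_multiples]]
    unfolding elt_set_times_def by blast
  show "mon_span (range ((+) t)) \<subseteq> (mono_of t :: 't \<Rightarrow>\<^sub>0 'k) *o UNIV"
    by (rule mon_span_subset[OF is_ideal_elt_set_times[OF is_ideal_UNIV]])
      (auto simp: mono_of_add)
qed

lemma ideal_gen_mono_of:
  "ideal_gen (mono_of ` B) =
    (mon_span {t. \<exists>s\<in>B. mdvd s t} :: ('t::comm_monoid_add \<Rightarrow>\<^sub>0 'k::field) set)" (is "?L = ?R")
proof
  have "mult_closed {t. \<exists>s\<in>B. mdvd s t}"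
    by (auto simp: mult_closed_def mdvd_def) (metis add.assoc)
  moreover have "mdvd t t" for t :: 't by (metis add.right_neutral mdvd_def)
  then have "mono_of ` B \<subseteq> ?R" by fastforce
  ultimately show "?L \<subseteq> ?R" by (intro ideals.span_minimal is_ideal_mon_span)
  show "?R \<subseteq> ?L"
    by (rule mon_span_subset) (auto simp: mono_in_ideal_gen_iff)
qed

lemma lookup_mono_of_mult:
  "Poly_Mapping.lookup (mono_of u * (f :: 't::cancel_comm_monoid_add \<Rightarrow>\<^sub>0 'k::comm_ring_1)) (u + t) =
    Poly_Mapping.lookup f t"
proof -
  have "mono_of u * f = mono_of u * restr UNIV f" by (simp add: restr_UNIV)
  also have "\<dots> = (\<Sum>s\<in>Poly_Mapping.keys f. Poly_Mapping.single (u + s) (Poly_Mapping.lookup f s))"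
    by (simp add: restr_def sum_distrib_left mono_of_def mult_single)
  finally show ?thesis
    by (auto simp: lookup_sum lookup_single when_def in_keys_iff cong: if_cong)
qed

text \<open>Multiplication by a monomial only shifts the support. This computes the colon ideal
  needed in \<open>rseq_colon\<close>.\<close>

lemma mono_of_mult_in_mon_span:
  "mono_of u * (f :: 't::cancel_comm_monoid_add \<Rightarrow>\<^sub>0 'k::comm_ring_1) \<in> mon_span T \<longleftrightarrow>
    f \<in> mon_span {t. u + t \<in> T}"
proof
  assume "mono_of u * f \<in> mon_span T"
  then show "f \<in> mon_span {t. u + t \<in> T}"
    by (auto simp: mon_span_def in_keys_iff subset_iff) (metis lookup_mono_of_mult)
next
  assume f: "f \<in> mon_span {t. u + t \<in> T}"
  show "mono_of u * f \<in> mon_span T"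
    using f keys_mult[of "mono_of u" f] by (fastforce simp: mon_span_def mono_of_def)
qed

lemma mono_of_mult_cancel:
  assumes "mono_of u * f = mono_of u * (g :: 't::cancel_comm_monoid_add \<Rightarrow>\<^sub>0 'k::comm_ring_1)"
  shows "f = g"
  by (rule poly_mapping_eqI) (metis assms lookup_mono_of_mult)

text \<open>The common step of both filtrations, by monomials of large support and by the products
  \<open>u^a\<close>: the new subquotient is S modulo the colon ideal by the adjoined
  monomial.\<close>

lemma rseq_adjoin_mono:
  assumes T: "mult_closed T" and reg: "rseq UNIV (mon_span {t. b + t \<in> T}) fs"
  shows "rseq (mon_span (T \<union> range ((+) b))) (mon_span T ::
    ('t::cancel_comm_monoid_add \<Rightarrow>\<^sub>0 'k::comm_ring_1) set) fs"
proof -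
  have "mult_closed {t. b + t \<in> T}" using T by (auto simp: mult_closed_def add.assoc[symmetric])
  then have "rseq (mon_span T + mono_of b *o UNIV) (mon_span T :: ('t \<Rightarrow>\<^sub>0 'k) set) fs"
    using rseq_colon[OF is_ideal_mon_span[OF T] is_ideal_mon_span mono_of_mult_in_mon_span
        mono_of_mult_cancel reg] by simp
  then show ?thesis by (simp add: mon_span_Un mono_of_times_UNIV)
qed

section \<open>Degrees and truncation\<close>

lemma mdeg_add: "mdeg (s + t) = mdeg s + mdeg t"
  by (simp add: mdeg_def lookup_add sum.distrib)

lemma mdeg_0 [simp]: "mdeg 0 = 0"
  by (simp add: mdeg_def)

lemma mdeg_evar [simp]: "mdeg (evar i) = 1"
  by (simp add: mdeg_def evar_def lookup_single when_def)

definition homogeneous :: "nat \<Rightarrow> (('n::finite \<Rightarrow>\<^sub>0 nat) \<Rightarrow>\<^sub>0 'k::zero) \<Rightarrow> bool"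
  where "homogeneous d f \<longleftrightarrow> (\<forall>t\<in>Poly_Mapping.keys f. mdeg t = d)"

abbreviation below :: "nat \<Rightarrow> ('n::finite \<Rightarrow>\<^sub>0 nat) set"
  where "below k \<equiv> {t. mdeg t < k}"

text \<open>For an ideal this is homogeneity: differences of consecutive truncations are the
  homogeneous components.\<close>

definition trunc_closed :: "(('n::finite \<Rightarrow>\<^sub>0 nat) \<Rightarrow>\<^sub>0 'k::comm_monoid_add) set \<Rightarrow> bool"
  where "trunc_closed A \<longleftrightarrow> (\<forall>k. \<forall>f\<in>A. restr (below k) f \<in> A)"

lemma homogeneous_power: "homogeneous d f \<Longrightarrow> homogeneous (k * d) (f ^ k :: _ \<Rightarrow>\<^sub>0 'k::comm_ring_1)"
proof (induction k)
  case 0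
  then show ?case by (simp add: homogeneous_def)
next
  case (Suc k)
  show ?case unfolding homogeneous_def
  proof
    fix t assume "t \<in> Poly_Mapping.keys (f ^ Suc k)"
    then obtain a b where "t = a + b" "a \<in> Poly_Mapping.keys f" "b \<in> Poly_Mapping.keys (f ^ k)"
      using keys_mult[of f "f ^ k"] by auto
    then show "mdeg t = Suc k * d" using Suc by (simp add: homogeneous_def mdeg_add)
  qed
qed

text \<open>Multiplication by f raises every degree by d. If k < d, then \<open>k - d\<close> is 0
  and \<open>below 0\<close> is empty, so both sides vanish.\<close>

lemma restr_below_mult:
  assumes f: "homogeneous d (f :: ('n::finite \<Rightarrow>\<^sub>0 nat) \<Rightarrow>\<^sub>0 'k::comm_ring_1)"
  shows "restr (below k) (f * g) = f * restr (below (k - d)) g"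
proof -
  let ?g1 = "restr (below (k - d)) g" and ?g2 = "restr (- below (k - d)) g"
  have deg: "\<exists>b\<in>Poly_Mapping.keys h. mdeg t = d + mdeg b" if t: "t \<in> Poly_Mapping.keys (f * h)" for t h
  proof -
    obtain a c where "t = a + c" "a \<in> Poly_Mapping.keys f" "c \<in> Poly_Mapping.keys h"
      using t keys_mult[of f h] by blast
    then show ?thesis using f by (auto simp: homogeneous_def mdeg_add)
  qed
  have "restr (below k) (f * ?g1) = f * ?g1"
    by (rule restr_eq_self) (auto dest!: deg simp: keys_restr)
  moreover have "restr (below k) (f * ?g2) = 0"
    by (rule restr_eq_0) (auto dest!: deg simp: keys_restr)
  moreover have "f * g = f * ?g1 + f * ?g2"
    using restr_split[of g "below (k - d)"] by (metis distrib_left)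
  ultimately show ?thesis by (simp add: restr_add)
qed

lemma trunc_closed_mon_span: "trunc_closed (mon_span T)"
  by (auto simp: trunc_closed_def mon_span_def keys_restr)

lemma trunc_closed_adjoin:
  assumes "trunc_closed B" "homogeneous d (f :: ('n::finite \<Rightarrow>\<^sub>0 nat) \<Rightarrow>\<^sub>0 'k::comm_ring_1)"
  shows "trunc_closed (B + f *o UNIV)"
  unfolding trunc_closed_def
proof (intro allI ballI)
  fix k g assume "g \<in> B + f *o UNIV"
  then obtain b a where "g = b + f * a" "b \<in> B" by (rule set_plus_elt_times_cases)
  then show "restr (below k) g \<in> B + f *o UNIV"
    using assms
    by (auto simp: restr_add restr_below_mult trunc_closed_def intro!: set_plus_intro set_times_intro2)
qed

text \<open>A graded Nakayama argument: truncation in degrees below \<open>k\<close> kills multiples of \<open>z^k\<close>.\<close>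

lemma rseq_lift:
  fixes z :: "('n::finite \<Rightarrow>\<^sub>0 nat) \<Rightarrow>\<^sub>0 'k::comm_ring_1"
  assumes z: "homogeneous 1 z"
  shows "is_ideal B \<Longrightarrow> trunc_closed B \<Longrightarrow> \<forall>f\<in>set fs. \<exists>d. homogeneous d f \<Longrightarrow>
    \<forall>g. z * g \<in> B \<longrightarrow> g \<in> B \<Longrightarrow> rseq UNIV (B + z *o UNIV) fs \<Longrightarrow> rseq UNIV B fs"
proof (induction fs arbitrary: B)
  case (Cons f fs)
  obtain d where d: "homogeneous d f" using Cons.prems(3) by auto
  have f: "g \<in> B + z *o UNIV" if "f * g \<in> B + z *o UNIV" for g
    using Cons.prems(5) that by simp
  have zk: "g \<in> B" if "z ^ k * g \<in> B" for g k
    using that Cons.prems(4) by (induction k) (auto simp: mult.assoc)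
  have "g \<in> B" if fg: "f * g \<in> B" for g
  proof -
    \<comment> \<open>Each round cancels z^k from z^k f h and uses regularity of f modulo B + (z) to
      split off one more factor z from h.\<close>
    have ex: "\<exists>b\<in>B. \<exists>h. g = b + z ^ k * h" for k
    proof (induction k)
      case 0
      have "g = 0 + z ^ 0 * g" by simp
      then show ?case using ideals.subspace_0[OF Cons.prems(1)] by blast
    next
      case (Suc k)
      then obtain b h where bh: "b \<in> B" "g = b + z ^ k * h" by blast
      have "z ^ k * (f * h) = f * g - f * b" unfolding bh(2) by (simp add: algebra_simps)
      also have "\<dots> \<in> B"
        using fg bh(1) ideals.subspace_diff[OF Cons.prems(1)] ideals.subspace_scale[OF Cons.prems(1)]
        by blast
      finally have "f * h \<in> B" by (rule zk)
      then have "f * h \<in> B + z *o UNIV"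
        using subset_set_plus1[OF is_ideal_elt_set_times[OF is_ideal_UNIV]] by (meson subsetD)
      then have "h \<in> B + z *o UNIV" by (rule f)
      then obtain b' h' where h: "h = b' + z * h'" "b' \<in> B" by (rule set_plus_elt_times_cases)
      have "g = (b + z ^ k * b') + z ^ Suc k * h'" unfolding bh(2) h(1) by (simp add: algebra_simps)
      moreover have "b + z ^ k * b' \<in> B"
        using bh(1) h(2) ideals.subspace_add[OF Cons.prems(1)] ideals.subspace_scale[OF Cons.prems(1)]
        by blast
      ultimately show ?case by blast
    qed
    \<comment> \<open>This k exceeds every degree in g, so truncation fixes g and kills z^k h; g is
      then a truncation of an element of B.\<close>
    obtain k where k: "Poly_Mapping.keys g \<subseteq> below k"
    proof -
      have "mdeg ` Poly_Mapping.keys g \<subseteq> {..<Suc (Max (mdeg ` Poly_Mapping.keys g))}"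
        by (auto simp: less_Suc_eq_le)
      then show ?thesis by (intro that[of "Suc (Max (mdeg ` Poly_Mapping.keys g))"]) auto
    qed
    obtain b h where bh: "b \<in> B" "g = b + z ^ k * h" using ex by blast
    have "homogeneous k (z ^ k)" using homogeneous_power[OF z, of k] by simp
    then have "restr (below k) (z ^ k * h) = z ^ k * restr (below 0) h"
      by (simp add: restr_below_mult)
    also have "restr (below 0) h = 0" by (rule restr_eq_0) simp
    finally have "restr (below k) g = restr (below k) b" by (simp add: bh(2) restr_add)
    then have "g = restr (below k) b" using k by (simp add: restr_eq_self)
    then show "g \<in> B" using Cons.prems(2) bh(1) by (simp add: trunc_closed_def)
  qed
  moreover have "rseq UNIV (B + f *o UNIV) fs"
  proof (rule Cons.IH)
    show "is_ideal (B + f *o UNIV)"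
      using Cons.prems(1) is_ideal_elt_set_times[OF is_ideal_UNIV] by (rule is_ideal_set_plus)
    show "trunc_closed (B + f *o UNIV)" using Cons.prems(2) d by (rule trunc_closed_adjoin)
    show "\<forall>f\<in>set fs. \<exists>d. homogeneous d f" using Cons.prems(3) by simp
    \<comment> \<open>Exchanging z, f for f, z keeps z regular modulo B + (f), as the induction
      hypothesis demands.\<close>
    have "rseq UNIV (B + z *o UNIV) [f]" using Cons.prems(5) by simp
    from regular_after_rseq[OF is_ideal_UNIV Cons.prems(1) _ _ this] Cons.prems(4)
    show "\<forall>g. z * g \<in> B + f *o UNIV \<longrightarrow> g \<in> B + f *o UNIV" by (simp add: set_zero)
    show "rseq UNIV (B + f *o UNIV + z *o UNIV) fs"
      using Cons.prems(5) by (simp add: add.assoc add.commute[of "f *o UNIV"])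
  qed
  ultimately show ?case by simp
qed simp


section \<open>Elementary symmetric polynomials and depth\<close>

lemma mdvd_iff: "mdvd s (t :: 'v \<Rightarrow>\<^sub>0 nat) \<longleftrightarrow>
    (\<forall>i. Poly_Mapping.lookup s i \<le> Poly_Mapping.lookup t i)"
proof
  assume "\<forall>i. Poly_Mapping.lookup s i \<le> Poly_Mapping.lookup t i"
  then have "t = s + (t - s)"
    by (intro poly_mapping_eqI) (simp add: lookup_add minus_poly_mapping.rep_eq)
  then show "mdvd s t" unfolding mdvd_def by blast
qed (auto simp: mdvd_def lookup_add)

lemma lookup_evar: "Poly_Mapping.lookup (evar i) j = (if i = j then 1 else 0)"
  by (simp add: evar_def lookup_single when_def)

lemma evar_mdvd_iff: "mdvd (evar i) t \<longleftrightarrow> Poly_Mapping.lookup t i \<noteq> 0"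
  by (auto simp: mdvd_iff lookup_evar Suc_le_eq)

definition sqfree :: "'n::finite set \<Rightarrow> 'n \<Rightarrow>\<^sub>0 nat"
  where "sqfree F = (\<Sum>i\<in>F. evar i)"

lemma lookup_sqfree: "Poly_Mapping.lookup (sqfree F) i = (if i \<in> F then 1 else 0)"
  by (simp add: sqfree_def lookup_sum lookup_evar)

lemma mdeg_sqfree: "mdeg (sqfree F) = card F"
  by (simp add: mdeg_def lookup_sqfree sum.If_cases)

definition esym :: "nat \<Rightarrow> ('n::finite \<Rightarrow>\<^sub>0 nat) \<Rightarrow>\<^sub>0 'k::comm_ring_1"
  where "esym s = (\<Sum>F | card F = s. mono_of (sqfree F))"

text \<open>The list starts at e_1, since e_0 = 1 is a unit; entry i is therefore e_{i+1}.\<close>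

definition esyms :: "nat \<Rightarrow> (('n::finite \<Rightarrow>\<^sub>0 nat) \<Rightarrow>\<^sub>0 'k::comm_ring_1) list"
  where "esyms s = map esym [1..<Suc s]"

lemma esyms_0 [simp]: "esyms 0 = []"
  by (simp add: esyms_def)

lemma esyms_Suc: "esyms (Suc s) = esyms s @ [esym (Suc s)]"
  by (simp add: esyms_def)

lemma length_esyms [simp]: "length (esyms s) = s"
  by (simp add: esyms_def)

lemma take_esyms: "i \<le> s \<Longrightarrow> take i (esyms s) = esyms i"
  by (simp add: esyms_def take_map take_upt del: upt_Suc)

lemma nth_esyms: "i < s \<Longrightarrow> esyms s ! i = esym (Suc i)"
  unfolding esyms_def by (subst nth_map) (simp_all del: upt_Suc)

lemma rseq_esyms_le: "rseq A B (esyms t) \<Longrightarrow> s \<le> t \<Longrightarrow> rseq A B (esyms s)"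
  by (metis append_take_drop_id rseq_append take_esyms)

lemma keys_esym:
  "t \<in> Poly_Mapping.keys (esym s :: ('n::finite \<Rightarrow>\<^sub>0 nat) \<Rightarrow>\<^sub>0 'k::comm_ring_1) \<Longrightarrow>
    \<exists>F. card F = s \<and> t = sqfree F"
proof -
  assume t: "t \<in> Poly_Mapping.keys (esym s :: ('n \<Rightarrow>\<^sub>0 nat) \<Rightarrow>\<^sub>0 'k)"
  then obtain F :: "'n set" where "card F = s"
    "t \<in> Poly_Mapping.keys (mono_of (sqfree F) :: ('n \<Rightarrow>\<^sub>0 nat) \<Rightarrow>\<^sub>0 'k)"
    unfolding esym_def in_keys_iff lookup_sum by (auto elim: sum.not_neutral_contains_not_neutral)
  then show ?thesis by (auto simp: mono_of_def)
qed

lemma homogeneous_esym: "homogeneous s (esym s)"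
  by (auto simp: homogeneous_def dest!: keys_esym simp: mdeg_sqfree)

lemma homogeneous_esyms: "f \<in> set (esyms s) \<Longrightarrow> \<exists>d. homogeneous d f"
  using homogeneous_esym by (auto simp: esyms_def)

text \<open>\<open>mon_span (coord Q)\<close> is the ideal generated by the x_i with i in Q; modulo
  it, S becomes the polynomial ring in the other variables.\<close>

definition coord :: "'n set \<Rightarrow> ('n \<Rightarrow>\<^sub>0 nat) set"
  where "coord Q = {t. \<exists>i\<in>Q. Poly_Mapping.lookup t i \<noteq> 0}"

lemma mult_closed_coord: "mult_closed (coord Q)"
  by (auto simp: mult_closed_def coord_def lookup_add)

lemma coord_insert: "coord (insert z Q) = coord Q \<union> range ((+) (evar z))"
  using evar_mdvd_iff[of z] by (auto simp: coord_def mdvd_def image_def)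

lemma mono_evar_regular:
  assumes "z \<notin> Q" "mono_of (evar z) * g \<in> mon_span (coord Q)"
  shows "(g :: ('n \<Rightarrow>\<^sub>0 nat) \<Rightarrow>\<^sub>0 'k::comm_ring_1) \<in> mon_span (coord Q)"
proof -
  have "{t. evar z + t \<in> coord Q} = coord Q"
    using assms(1) by (auto simp: coord_def lookup_add lookup_evar)
  then show ?thesis using assms(2) by (simp add: mono_of_mult_in_mon_span)
qed

text \<open>Every s-element set other than the complement of Q meets Q, so only the product of the
  remaining variables survives modulo the variables in Q.\<close>

lemma esym_mod_coord:
  assumes "card (- Q) = s"
  shows "esym s - mono_of (sqfree (- Q)) \<in>
    (mon_span (coord Q) :: (('n::finite \<Rightarrow>\<^sub>0 nat) \<Rightarrow>\<^sub>0 'k::comm_ring_1) set)"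
proof -
  let ?A = "{F :: 'n set. card F = s}"
  have "esym s = (mono_of (sqfree (- Q)) :: ('n \<Rightarrow>\<^sub>0 nat) \<Rightarrow>\<^sub>0 'k) +
      (\<Sum>F\<in>?A - {- Q}. mono_of (sqfree F))"
    unfolding esym_def using assms by (subst sum.remove[of _ "- Q"]) auto
  moreover have "(\<Sum>F\<in>?A - {- Q}. mono_of (sqfree F)) \<in>
      (mon_span (coord Q) :: (('n \<Rightarrow>\<^sub>0 nat) \<Rightarrow>\<^sub>0 'k) set)"
  proof (rule ideals.subspace_sum[OF is_ideal_mon_span[OF mult_closed_coord]])
    fix F assume F: "F \<in> ?A - {- Q}"
    then have "\<not> F \<subseteq> - Q" using assms card_subset_eq[of "- Q" F] by auto
    then show "mono_of (sqfree F) \<in> (mon_span (coord Q) :: (('n \<Rightarrow>\<^sub>0 nat) \<Rightarrow>\<^sub>0 'k) set)"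
      by (auto simp: coord_def lookup_sqfree)
  qed
  ultimately show ?thesis by simp
qed

text \<open>Induction on the number of variables outside Q. Killing one more variable z leaves
  elementary symmetric polynomials in the others, so all but the last one lift by
  \<open>rseq_lift\<close>. The last one is the product of the remaining variables, each of which is
  regular modulo the preceding ones.\<close>

lemma rseq_coord:
  "s \<le> m \<Longrightarrow> card (- Q) = m \<Longrightarrow>
    rseq UNIV (mon_span (coord Q) :: (('n::finite \<Rightarrow>\<^sub>0 nat) \<Rightarrow>\<^sub>0 'k::comm_ring_1) set) (esyms s)"
proof (induction m arbitrary: Q s)
  case (Suc m)
  let ?P = "\<lambda>Q. mon_span (coord Q) :: (('n \<Rightarrow>\<^sub>0 nat) \<Rightarrow>\<^sub>0 'k) set"
  let ?x = "\<lambda>z. mono_of (evar z) :: ('n \<Rightarrow>\<^sub>0 nat) \<Rightarrow>\<^sub>0 'k"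
  have ideal: "is_ideal (?P Q)" by (rule is_ideal_mon_span[OF mult_closed_coord])
  have ins: "rseq UNIV (?P Q + ?x z *o UNIV) (esyms r)" if "z \<notin> Q" "r \<le> m" for z r
  proof -
    have "- insert z Q = - Q - {z}" by auto
    then have "card (- insert z Q) = m" using Suc.prems(2) that(1) by simp
    then show ?thesis
      using Suc.IH[OF that(2), of "insert z Q"] by (simp add: coord_insert mon_span_Un mono_of_times_UNIV)
  qed
  have le: "rseq UNIV (?P Q) (esyms r)" if "r \<le> m" for r
  proof -
    have "- Q \<noteq> {}" using Suc.prems(2) by auto
    then obtain z where z: "z \<notin> Q" by blast
    show ?thesis
    proof (rule rseq_lift[OF _ ideal trunc_closed_mon_span])
      show "homogeneous 1 (?x z)" by (simp add: homogeneous_def mono_of_def)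
      show "\<forall>f\<in>set (esyms r). \<exists>d. homogeneous d (f :: ('n \<Rightarrow>\<^sub>0 nat) \<Rightarrow>\<^sub>0 'k)"
        using homogeneous_esyms by blast
      show "\<forall>g. ?x z * g \<in> ?P Q \<longrightarrow> g \<in> ?P Q" using mono_evar_regular[OF z] by blast
      show "rseq UNIV (?P Q + ?x z *o UNIV) (esyms r)" using z that by (rule ins)
    qed
  qed
  show ?case
  proof (cases "s = Suc m")
    case True
    define L where "L = ?P Q + gen_by UNIV (esyms m)"
    have L: "is_ideal L" unfolding L_def
      using ideal is_ideal_gen_by[OF is_ideal_UNIV] by (rule is_ideal_set_plus)
    have "?P Q \<subseteq> L" unfolding L_def by (rule subset_set_plus1[OF is_ideal_gen_by[OF is_ideal_UNIV]])
    \<comment> \<open>The exchange lemma with z in front: z is regular modulo Q, and e_1, ..., e_m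
      is regular after killing z.\<close>
    have var: "g \<in> L" if "z \<notin> Q" "?x z * g \<in> L" for z g
      using regular_after_rseq[OF is_ideal_UNIV ideal _ _ ins[OF that(1) order_refl]]
        mono_evar_regular[OF that(1)] that(2) by (auto simp: L_def)
    have prod: "g \<in> L" if "F \<inter> Q = {}" "mono_of (sqfree F) * g \<in> L" for F g
      using finite[of F] that
    proof (induction F arbitrary: g)
      case empty
      then show ?case by (simp add: sqfree_def mono_of_def)
    next
      case (insert z F)
      have "mono_of (sqfree (insert z F)) = mono_of (sqfree F) * ?x z"
        using insert.hyps by (simp add: sqfree_def mono_of_add mult.commute)
      then have "?x z * g \<in> L" using insert.prems by (simp add: mult.assoc insert.IH[of "?x z * g"])
      then show ?case using insert.prems var by auto
    qed
    have "g \<in> L" if g: "esym (Suc m) * g \<in> L" for g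
    proof -
      have "(esym (Suc m) - mono_of (sqfree (- Q))) * g \<in> L"
        by (intro ideal_mult_right[OF L] subsetD[OF \<open>?P Q \<subseteq> L\<close>] esym_mod_coord[OF Suc.prems(2)])
      then have "esym (Suc m) * g - (esym (Suc m) - mono_of (sqfree (- Q))) * g \<in> L"
        using g by (intro ideals.subspace_diff[OF L])
      then have "mono_of (sqfree (- Q)) * g \<in> L" by (simp add: left_diff_distrib)
      then show ?thesis using prod[of "- Q" g] by auto
    qed
    then show ?thesis using le[of m] by (simp add: True esyms_Suc rseq_append L_def)
  qed (use le Suc.prems in auto)
qed simp

lemma rseq_UNIV_0:
  assumes "s \<le> CARD('n::finite)"
  shows "rseq UNIV (0 :: (('n \<Rightarrow>\<^sub>0 nat) \<Rightarrow>\<^sub>0 'k::comm_ring_1) set) (esyms s)"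
proof -
  have 0: "mon_span (coord {}) = (0 :: (('n \<Rightarrow>\<^sub>0 nat) \<Rightarrow>\<^sub>0 'k) set)"
    by (auto simp: mon_span_def coord_def set_zero)
  have "card (- {} :: 'n set) = CARD('n)" by simp
  with assms have "rseq UNIV (mon_span (coord {}) :: (('n \<Rightarrow>\<^sub>0 nat) \<Rightarrow>\<^sub>0 'k) set) (esyms s)"
    by (rule rseq_coord)
  then show ?thesis by (simp only: 0)
qed

section \<open>Enlarging a monomial ideal by monomials of large support\<close>

lemma rseq_self: "is_ideal A \<Longrightarrow> rseq A A fs"
proof (induction fs)
  case (Cons f fs)
  then have "A + f *o A = A"
    by (intro ideal_absorb elt_set_times_subset is_ideal_elt_set_times)
  then show ?case using Cons by simp
qed simp

text \<open>Holds as soon as N bounds all exponents of a generating set; it reduces membership in T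
  to the finite box of exponents at most N.\<close>

definition capped :: "nat \<Rightarrow> ('n \<Rightarrow>\<^sub>0 nat) set \<Rightarrow> bool"
  where "capped N T \<longleftrightarrow> (\<forall>p q. (\<forall>i. min N (Poly_Mapping.lookup p i) = min N (Poly_Mapping.lookup q i)) \<longrightarrow>
    p \<in> T \<longrightarrow> q \<in> T)"

lemma cappedD: "capped N T \<Longrightarrow> p \<in> T \<Longrightarrow>
    (\<And>i. min N (Poly_Mapping.lookup p i) = min N (Poly_Mapping.lookup q i)) \<Longrightarrow> q \<in> T"
  unfolding capped_def by blast

lemma capped_multiples:
  assumes "\<And>s i. s \<in> U \<Longrightarrow> Poly_Mapping.lookup s i \<le> N"
  shows "capped N {t. \<exists>s\<in>U. mdvd s t}"
  unfolding capped_def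
proof (intro allI impI, clarify)
  fix p q s assume eq: "\<forall>i. min N (Poly_Mapping.lookup p i) = min N (Poly_Mapping.lookup q i)"
    and s: "s \<in> U" "mdvd s p"
  have "Poly_Mapping.lookup s i \<le> Poly_Mapping.lookup q i" for i
  proof -
    have "Poly_Mapping.lookup s i \<le> min N (Poly_Mapping.lookup p i)"
      using assms[OF s(1)] s(2) by (simp add: mdvd_iff)
    then show ?thesis using eq by simp
  qed
  then show "\<exists>s\<in>U. mdvd s q" using s(1) by (auto simp: mdvd_iff)
qed

lemma finite_box: "finite {p :: 'n::finite \<Rightarrow>\<^sub>0 nat. \<forall>i. Poly_Mapping.lookup p i \<le> N}"
proof (rule finite_imageD)
  show "finite (Poly_Mapping.lookup ` {p :: 'n \<Rightarrow>\<^sub>0 nat. \<forall>i. Poly_Mapping.lookup p i \<le> N})"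
    by (rule finite_subset[OF _ finite_set_of_finite_funs[of UNIV "{..N}" 0]]) auto
  show "inj_on Poly_Mapping.lookup {p :: 'n \<Rightarrow>\<^sub>0 nat. \<forall>i. Poly_Mapping.lookup p i \<le> N}"
    by (auto simp: inj_on_def intro: poly_mapping_eqI)
qed

text \<open>Monomials are added one at a time, each of maximal degree among those that are still missing and
  have at most \<open>N\<close> in each exponent, so that each step adds a copy of a polynomial ring in at least
  \<open>s\<close> variables.\<close>

lemma rseq_adjoin_large_support:
  assumes "mult_closed T" "capped N T"
  shows "\<exists>T'. T \<subseteq> T' \<and> mult_closed T' \<and>
    (\<forall>p. s \<le> card {i. N \<le> Poly_Mapping.lookup p i} \<longrightarrow> p \<in> T') \<and>
    rseq (mon_span T') (mon_span T :: (('n::finite \<Rightarrow>\<^sub>0 nat) \<Rightarrow>\<^sub>0 'k::comm_ring_1) set) (esyms s)"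
  using assms
proof (induction "card ({p. \<forall>i. Poly_Mapping.lookup p i \<le> N} - T)" arbitrary: T rule: less_induct)
  case less
  let ?Box = "{p :: 'n \<Rightarrow>\<^sub>0 nat. \<forall>i. Poly_Mapping.lookup p i \<le> N}"
  let ?big = "\<lambda>p :: 'n \<Rightarrow>\<^sub>0 nat. s \<le> card {i. N \<le> Poly_Mapping.lookup p i}"
  let ?M = "{p \<in> ?Box - T. ?big p}"
  have fin: "finite (?Box - T)" using finite_box by blast
  show ?case
  proof (cases "?M = {}")
    case True
    have "p \<in> T" if "?big p" for p
    proof -
      \<comment> \<open>Cutting p off at N lands in the box and changes neither the places of large
        exponents nor membership in T.\<close>
      let ?q = "Abs_poly_mapping (\<lambda>i. min N (Poly_Mapping.lookup p i))"
      have q: "Poly_Mapping.lookup ?q i = min N (Poly_Mapping.lookup p i)" for i by simp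
      have "?q \<in> ?Box" "?big ?q" using that by (simp_all only: q mem_Collect_eq) auto
      then have "?q \<in> T" using True by blast
      then show ?thesis by (rule cappedD[OF less.prems(2)]) (simp add: q)
    qed
    then show ?thesis using less.prems rseq_self[OF is_ideal_mon_span] by blast
  next
    case False
    have "finite ?M" by (rule finite_subset[OF _ fin]) auto
    then have "Max (mdeg ` ?M) \<in> mdeg ` ?M" using False by (intro Max_in) auto
    then obtain b where bM: "b \<in> ?M" "Max (mdeg ` ?M) = mdeg b" by (rule imageE) simp
    then have b: "b \<in> ?Box" "b \<notin> T" "?big b" by simp_all
    have max: "mdeg p \<le> mdeg b" if "p \<in> ?M" for p
      unfolding bM(2)[symmetric] using \<open>finite ?M\<close> that by (intro Max_ge) auto
    let ?Q = "{i. Poly_Mapping.lookup b i < N}" and ?T = "T \<union> range ((+) b)"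
    \<comment> \<open>The product of x^b and x_i stays in the box and keeps its large exponents, but
      has larger degree, so maximality of b puts it in T.\<close>
    have "b + t \<in> T" if t: "t \<in> coord ?Q" for t
    proof -
      obtain i where i: "Poly_Mapping.lookup b i < N" "Poly_Mapping.lookup t i \<noteq> 0"
        using t by (auto simp: coord_def)
      have "b + evar i \<in> ?Box" using b(1) i(1) by (auto simp: lookup_add lookup_evar)
      moreover have "?big (b + evar i)"
        using b(3) by (rule order_trans) (auto intro!: card_mono intro: trans_le_add1 simp: lookup_add)
      ultimately have "b + evar i \<in> T"
        using max[of "b + evar i"] by (auto simp: mdeg_add)
      moreover obtain r where "t = evar i + r" using i(2) evar_mdvd_iff[of i t] unfolding mdvd_def by blast
      ultimately show ?thesis
        using less.prems(1) by (auto simp: mult_closed_def add.assoc[symmetric])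
    qed
    \<comment> \<open>Outside Q the exponents of b equal N, so a t supported there cannot be
      detected after capping.\<close>
    moreover have "t \<in> coord ?Q" if "b + t \<in> T" for t
    proof (rule ccontr)
      assume "t \<notin> coord ?Q"
      then have "b \<in> T" using that
        by (intro cappedD[OF less.prems(2) that]) (force simp: coord_def lookup_add min_def)
      then show False using b by simp
    qed
    ultimately have colon: "{t. b + t \<in> T} = coord ?Q" by blast
    have "- ?Q = {i. N \<le> Poly_Mapping.lookup b i}" by auto
    then have "rseq UNIV (mon_span (coord ?Q) :: (('n \<Rightarrow>\<^sub>0 nat) \<Rightarrow>\<^sub>0 'k) set) (esyms s)"
      using b(3) by (intro rseq_coord) auto
    then have step: "rseq (mon_span ?T) (mon_span T :: (('n \<Rightarrow>\<^sub>0 nat) \<Rightarrow>\<^sub>0 'k) set) (esyms s)"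
      by (rule rseq_adjoin_mono[OF less.prems(1), of b, unfolded colon])
    have T: "mult_closed ?T" using less.prems(1) by (simp add: mult_closed_Un mult_closed_multiples)
    have "capped N (range ((+) b))"
      using capped_multiples[of "{b}" N] b(1) by (simp add: mdvd_def full_SetCompr_eq)
    then have "capped N ?T" using less.prems(2) unfolding capped_def by blast
    moreover have "b \<in> ?T" by (metis UnI2 add.right_neutral rangeI)
    then have "?Box - ?T \<subset> ?Box - T" using b(1,2) by blast
    then have "card (?Box - ?T) < card (?Box - T)" by (rule psubset_card_mono[OF fin])
    ultimately obtain T' where T': "?T \<subseteq> T'" "mult_closed T'" "\<forall>p. ?big p \<longrightarrow> p \<in> T'"
      "rseq (mon_span T') (mon_span ?T :: (('n \<Rightarrow>\<^sub>0 nat) \<Rightarrow>\<^sub>0 'k) set) (esyms s)"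
      using less.hyps[OF _ T] by blast
    have "rseq (mon_span T') (mon_span T :: (('n \<Rightarrow>\<^sub>0 nat) \<Rightarrow>\<^sub>0 'k) set) (esyms s)"
    proof (rule rseq_extension[OF _ _ _ _ _ step T'(4)])
      show "mon_span T \<subseteq> (mon_span ?T :: (('n \<Rightarrow>\<^sub>0 nat) \<Rightarrow>\<^sub>0 'k) set)" by (auto simp: mon_span_def)
      show "mon_span ?T \<subseteq> (mon_span T' :: (('n \<Rightarrow>\<^sub>0 nat) \<Rightarrow>\<^sub>0 'k) set)"
        using T'(1) unfolding mon_span_def by blast
    qed (simp_all add: is_ideal_mon_span T T'(2) less.prems(1))
    then show ?thesis using T' by blast
  qed
qed

lemma lookup_keys_esym_power:
  "t \<in> Poly_Mapping.keys (esym s ^ k :: ('n::finite \<Rightarrow>\<^sub>0 nat) \<Rightarrow>\<^sub>0 'k::comm_ring_1) \<Longrightarrow>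
    Poly_Mapping.lookup t i \<le> k"
proof (induction k arbitrary: t)
  case (Suc k)
  then obtain a b where "t = a + b" "a \<in> Poly_Mapping.keys (esym s :: ('n \<Rightarrow>\<^sub>0 nat) \<Rightarrow>\<^sub>0 'k)"
    "b \<in> Poly_Mapping.keys (esym s ^ k :: ('n \<Rightarrow>\<^sub>0 nat) \<Rightarrow>\<^sub>0 'k)"
    using keys_mult[of "esym s" "esym s ^ k :: ('n \<Rightarrow>\<^sub>0 nat) \<Rightarrow>\<^sub>0 'k"] by (simp, blast)
  then show ?case using Suc.IH[of b] by (auto dest!: keys_esym simp: lookup_add lookup_sqfree)
qed simp

text \<open>A monomial of \<open>e_s^k\<close> has degree \<open>s k\<close> and all exponents at most \<open>k\<close>; if fewer than \<open>s\<close> of them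
  were at least \<open>N\<close>, the degree would be at most \<open>(s - 1) k + n N\<close>.\<close>

lemma esym_power_in_mon_span:
  assumes T: "\<And>p. s \<le> card {i. N \<le> Poly_Mapping.lookup p i} \<Longrightarrow> p \<in> T"
  shows "esym s ^ Suc (CARD('n) * N) \<in> (mon_span T :: (('n::finite \<Rightarrow>\<^sub>0 nat) \<Rightarrow>\<^sub>0 'k::comm_ring_1) set)"
proof -
  \<comment> \<open>With k > n N, the small exponents together cannot replace one missing exponent
    of size k.\<close>
  define k where "k = Suc (CARD('n) * N)"
  have "p \<in> T" if p: "p \<in> Poly_Mapping.keys (esym s ^ k :: ('n \<Rightarrow>\<^sub>0 nat) \<Rightarrow>\<^sub>0 'k)" for p
  proof (rule ccontr)
    let ?A = "{i. N \<le> Poly_Mapping.lookup p i}"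
    assume "p \<notin> T"
    then have card: "Suc (card ?A) \<le> s" using T[of p] by fastforce
    have "mdeg p = k * s"
      using p homogeneous_power[OF homogeneous_esym[of s], of k] unfolding homogeneous_def by blast
    moreover have "mdeg p = sum (Poly_Mapping.lookup p) ?A + sum (Poly_Mapping.lookup p) (- ?A)"
      unfolding mdeg_def by (simp add: sum.union_disjoint[symmetric] Compl_partition)
    moreover have "sum (Poly_Mapping.lookup p) ?A \<le> card ?A * k"
      by (rule order_trans[OF sum_bounded_above[where K = k]])
        (simp_all add: lookup_keys_esym_power[OF p] del: power_Suc)
    moreover have "sum (Poly_Mapping.lookup p) (- ?A) \<le> card (- ?A) * N"
      by (rule order_trans[OF sum_bounded_above[where K = N]]) simp_all
    moreover have "card (- ?A) * N \<le> CARD('n) * N" by (intro mult_right_mono card_mono) auto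
    moreover have "CARD('n) * N < k" by (simp add: k_def)
    moreover have "card ?A * k + k \<le> k * s" using mult_le_mono2[OF card, of k] by (simp add: ac_simps)
    ultimately show False by linarith
  qed
  then show ?thesis unfolding k_def mon_span_def by blast
qed

text \<open>Injectivity of I/(e_1, ..., e_{i+1}) I -> S/(e_1, ..., e_{i+1}) transfers regularity
  from S to S/I. It comes from \<open>gen_by_UNIV_Int\<close> with w = e_{i+2}, which is why I must
  carry one element more than S/I receives.\<close>

lemma esym_regular_mod_mon_span:
  assumes T: "mult_closed T" "capped N T"
    and reg: "rseq (mon_span T) (0 :: (('n \<Rightarrow>\<^sub>0 nat) \<Rightarrow>\<^sub>0 'k) set) (esyms (Suc s))" and s: "i < s" "s \<le> CARD('n)"
    and g: "esym (Suc i) * g \<in> mon_span T + gen_by UNIV (esyms i)"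
  shows "g \<in> mon_span T +
    gen_by UNIV (esyms i :: (('n::finite \<Rightarrow>\<^sub>0 nat) \<Rightarrow>\<^sub>0 'k::comm_ring_1) list)"
proof -
  let ?I = "mon_span T :: (('n \<Rightarrow>\<^sub>0 nat) \<Rightarrow>\<^sub>0 'k) set"
  let ?G = "gen_by UNIV (esyms i :: (('n \<Rightarrow>\<^sub>0 nat) \<Rightarrow>\<^sub>0 'k) list)"
  let ?e = "esym (Suc i) :: ('n \<Rightarrow>\<^sub>0 nat) \<Rightarrow>\<^sub>0 'k"
  have I: "is_ideal ?I" and G: "is_ideal ?G"
    using T(1) by (simp_all add: is_ideal_mon_span is_ideal_gen_by is_ideal_UNIV)
  obtain T' where T': "T \<subseteq> T'" "mult_closed T'"
    "\<forall>p. Suc (Suc i) \<le> card {i. N \<le> Poly_Mapping.lookup p i} \<longrightarrow> p \<in> T'"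
    "rseq (mon_span T') ?I (esyms (Suc (Suc i)))"
    using rseq_adjoin_large_support[OF T] by blast
  have "?I \<inter> gen_by UNIV (esyms (Suc i)) \<subseteq> gen_by ?I (esyms (Suc i))"
  proof (rule gen_by_UNIV_Int[OF I])
    show "is_ideal (mon_span T' :: (('n \<Rightarrow>\<^sub>0 nat) \<Rightarrow>\<^sub>0 'k) set)"
      using T'(2) by (rule is_ideal_mon_span)
    show "?I \<subseteq> mon_span T'" using T'(1) by (auto simp: mon_span_def)
    show "rseq (mon_span T') ?I (esyms (Suc i) @ [esym (Suc (Suc i))])"
      using T'(4) by (simp add: esyms_Suc)
    have "rseq ?I 0 (esyms (Suc (Suc i)))" using reg by (rule rseq_esyms_le) (use s in simp)
    then show "rseq ?I 0 (esyms (Suc i) @ [esym (Suc (Suc i))])" by (simp add: esyms_Suc)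
    show "esym (Suc (Suc i)) ^ Suc (CARD('n) * N) \<in> (mon_span T' :: (('n \<Rightarrow>\<^sub>0 nat) \<Rightarrow>\<^sub>0 'k) set)"
      using T'(3) by (intro esym_power_in_mon_span) blast
  qed
  \<comment> \<open>An element of I lying in (e_1, ..., e_{i+1}) can be written with coefficients in
    I.\<close>
  then have Int: "h \<in> gen_by ?I (esyms i) + ?e *o ?I" if "h \<in> ?I" "h \<in> ?G + ?e *o UNIV" for h
    using that by (auto simp: esyms_Suc gen_by_append)
  obtain h y where hy: "?e * g = h + y" "h \<in> ?I" "y \<in> ?G" using g by (rule set_plus_elim)
  have "h = - y + ?e * g" using hy(1) by simp
  then have "h \<in> ?G + ?e *o UNIV"
    using set_plus_intro[OF ideals.subspace_neg[OF G hy(3)] set_times_intro2[of g UNIV ?e]] by simp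
  then obtain v a where va: "h = v + ?e * a" "v \<in> gen_by ?I (esyms i)" "a \<in> ?I"
    using Int[OF hy(2)] set_plus_elt_times_cases by blast
  have "v \<in> ?G" using va(2) gen_by_mono[of ?I UNIV] by blast
  \<comment> \<open>Subtracting a from g removes the contribution of I; regularity on S itself
    finishes.\<close>
  moreover have "?e * (g - a) = v + y" using hy(1) va(1) by (simp add: algebra_simps)
  ultimately have "?e * (g - a) \<in> ?G" using hy(3) ideals.subspace_add[OF G] by metis
  moreover have "rseq UNIV (0 :: (('n \<Rightarrow>\<^sub>0 nat) \<Rightarrow>\<^sub>0 'k) set) (esyms (Suc i))"
    using s by (intro rseq_UNIV_0) simp
  ultimately have "g - a \<in> ?G" by (simp add: esyms_Suc rseq_append)
  then have "a + (g - a) \<in> ?I + ?G" using va(3) by (intro set_plus_intro)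
  then show ?thesis by simp
qed

text \<open>The list e_1, ..., e_s is a witness for the supremum. Since T omits 0, everything
  generated lies in the maximal ideal, which gives the required properness.\<close>

lemma depth_quot_mon_span_ge:
  assumes T: "mult_closed T" "capped N T" "0 \<notin> T" and s: "s \<le> CARD('n)"
    and reg: "rseq (mon_span T) (0 :: (('n \<Rightarrow>\<^sub>0 nat) \<Rightarrow>\<^sub>0 'k) set) (esyms (Suc s))"
  shows "enat s \<le> depth_quot (mon_span T :: (('n::finite \<Rightarrow>\<^sub>0 nat) \<Rightarrow>\<^sub>0 'k::field) set)"
proof -
  let ?I = "mon_span T :: (('n \<Rightarrow>\<^sub>0 nat) \<Rightarrow>\<^sub>0 'k) set"
  let ?m = "mon_span (- {0}) :: (('n \<Rightarrow>\<^sub>0 nat) \<Rightarrow>\<^sub>0 'k) set"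
  have I: "is_ideal ?I" using T(1) by (rule is_ideal_mon_span)
  have zero: "t + r = 0 \<Longrightarrow> t = 0" for t r :: "'n \<Rightarrow>\<^sub>0 nat"
    by (rule poly_mapping_eqI) (metis add_is_0 lookup_add lookup_zero)
  have m: "is_ideal ?m" using zero by (intro is_ideal_mon_span) (auto simp: mult_closed_def)
  have "t \<noteq> 0 \<longleftrightarrow> (\<exists>i. Poly_Mapping.lookup t i \<noteq> 0)" for t :: "'n \<Rightarrow>\<^sub>0 nat"
    by (metis poly_mapping_eqI lookup_zero)
  then have "- {0} = {t :: 'n \<Rightarrow>\<^sub>0 nat. \<exists>s\<in>range evar. mdvd s t}"
    by (simp add: evar_mdvd_iff set_eq_iff)
  moreover have "max_ideal = (ideal_gen (mono_of ` range evar) :: (('n \<Rightarrow>\<^sub>0 nat) \<Rightarrow>\<^sub>0 'k) set)"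
    by (simp add: max_ideal_def image_image)
  ultimately have "?m = max_ideal" by (simp add: ideal_gen_mono_of)
  moreover have esyms: "set (esyms s) \<subseteq> ?m"
  proof -
    have "t \<noteq> 0" if "t \<in> Poly_Mapping.keys (esym (Suc i) :: ('n \<Rightarrow>\<^sub>0 nat) \<Rightarrow>\<^sub>0 'k)" for i t
      using keys_esym[OF that] mdeg_sqfree by (metis mdeg_0 nat.distinct(1))
    then have "esym (Suc i) \<in> ?m" for i by (auto simp: mon_span_def)
    then show ?thesis by (auto simp: in_set_conv_nth nth_esyms)
  qed
  moreover have "regular_seq_quot ?I (esyms s)"
    unfolding regular_seq_quot_def
  proof (intro conjI allI impI)
    fix i g assume i: "i < length (esyms s :: (('n \<Rightarrow>\<^sub>0 nat) \<Rightarrow>\<^sub>0 'k) list)"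
      and "esyms s ! i * g \<in> ideal_gen (?I \<union> set (take i (esyms s)))"
    then show "g \<in> ideal_gen (?I \<union> set (take i (esyms s)))"
      using esym_regular_mod_mon_span[OF T(1,2) reg _ s, of i g]
      by (simp add: take_esyms nth_esyms ideal_gen_ideal_Un[OF I])
  next
    have "?I \<subseteq> ?m" using T(3) by (auto simp: mon_span_def)
    then have "ideal_gen (?I \<union> set (esyms s)) \<subseteq> ?m"
      using esyms m by (intro ideals.span_minimal) auto
    moreover have "1 \<notin> ?m" by (simp add: mon_span_def)
    ultimately show "ideal_gen (?I \<union> set (esyms s)) \<noteq> UNIV" by blast
  qed
  ultimately have "esyms s \<in> {fs. set fs \<subseteq> max_ideal \<and> regular_seq_quot ?I fs}" by simp
  then have "enat (length (esyms s :: (('n \<Rightarrow>\<^sub>0 nat) \<Rightarrow>\<^sub>0 'k) list)) \<le> depth_quot ?I"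
    unfolding depth_quot_def by (rule SUP_upper)
  then show ?thesis by (simp only: length_esyms)
qed


section \<open>The initial ideal of the Rees ideal\<close>

lemma mdvd_refl: "mdvd t t"
  unfolding mdvd_def by (rule exI[of _ 0]) simp

lemma mdvd_trans: "mdvd r s \<Longrightarrow> mdvd s t \<Longrightarrow> mdvd r t"
  unfolding mdvd_def by (auto simp: add.assoc)

text \<open>Descent along proper divisors. The size \<open>sz\<close> is left open because S uses
  the degree and A the total degree in both groups of variables.\<close>

lemma min_gens_dvd:
  fixes sz :: "'t::comm_monoid_add \<Rightarrow> nat" and L :: "('t \<Rightarrow>\<^sub>0 'k::field) set"
  assumes sz: "\<And>s t. mdvd s t \<Longrightarrow> s \<noteq> t \<Longrightarrow> sz s < sz t" and t: "mono_of t \<in> L"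
  shows "\<exists>s\<in>min_gens L. mdvd s t"
  using t
proof (induction "sz t" arbitrary: t rule: less_induct)
  case less
  show ?case
  proof (cases "t \<in> min_gens L")
    case True
    then show ?thesis using mdvd_refl by blast
  next
    case False
    then obtain s where s: "mono_of s \<in> L" "mdvd s t" "s \<noteq> t"
      using less.prems unfolding min_gens_def by blast
    then show ?thesis using less.hyps[OF sz[OF s(2,3)] s(1)] mdvd_trans by blast
  qed
qed

lemma mdeg_eq_0_iff: "mdeg t = 0 \<longleftrightarrow> t = 0"
proof
  assume "mdeg t = 0"
  then show "t = 0" by (intro poly_mapping_eqI) (simp add: mdeg_def)
qed simp

lemma mdeg_eq_1: "mdeg t = 1 \<Longrightarrow> \<exists>i. t = evar i"
proof -
  assume t: "mdeg t = 1"
  then have "t \<noteq> 0" by auto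
  then obtain i where "Poly_Mapping.lookup t i \<noteq> 0"
    using poly_mapping_eqI[of t 0] by (metis lookup_zero)
  then obtain r where r: "t = evar i + r" using evar_mdvd_iff[of i t] unfolding mdvd_def by blast
  then have "mdeg r = 0" using t by (simp add: mdeg_add)
  then show ?thesis using r by (auto simp: mdeg_eq_0_iff)
qed

lemma mdvd_mdeg_less: "mdvd s t \<Longrightarrow> s \<noteq> t \<Longrightarrow> mdeg s < mdeg t"
proof -
  assume "mdvd s t" "s \<noteq> t"
  then obtain r where "t = s + r" "r \<noteq> 0" unfolding mdvd_def by force
  then show "mdeg s < mdeg t" using mdeg_eq_0_iff[of r] by (simp add: mdeg_add)
qed

lemma mdvd_prod_iff: "mdvd (p, a) (q, b) \<longleftrightarrow> mdvd p q \<and> mdvd a b"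
  unfolding mdvd_def by auto

text \<open>The exponent of the product of the \<open>u_j^{a_j}\<close>; the inner constant sum is
  the multiple of \<open>u j\<close> by the j-th entry of a.\<close>

definition scaled_sum :: "('m::finite \<Rightarrow> 'n \<Rightarrow>\<^sub>0 nat) \<Rightarrow> ('m \<Rightarrow>\<^sub>0 nat) \<Rightarrow> 'n \<Rightarrow>\<^sub>0 nat"
  where "scaled_sum u a = (\<Sum>j\<in>UNIV. \<Sum>_<Poly_Mapping.lookup a j. u j)"

lemma lookup_scaled_sum: "Poly_Mapping.lookup (scaled_sum u a) i =
    (\<Sum>j\<in>UNIV. Poly_Mapping.lookup a j * Poly_Mapping.lookup (u j) i)"
  by (simp add: scaled_sum_def lookup_sum)

lemma scaled_sum_0 [simp]: "scaled_sum u 0 = 0"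
  by (simp add: scaled_sum_def)

lemma scaled_sum_add: "scaled_sum u (a + b) = scaled_sum u a + scaled_sum u b"
  by (rule poly_mapping_eqI) (simp add: lookup_scaled_sum lookup_add distrib_right sum.distrib)

lemma scaled_sum_evar: "scaled_sum u (evar j) = u j"
proof (rule poly_mapping_eqI)
  fix i
  have "Poly_Mapping.lookup (scaled_sum u (evar j)) i =
      (\<Sum>l\<in>UNIV. if j = l then Poly_Mapping.lookup (u l) i else 0)"
    unfolding lookup_scaled_sum by (rule sum.cong) (simp_all add: lookup_evar)
  then show "Poly_Mapping.lookup (scaled_sum u (evar j)) i = Poly_Mapping.lookup (u j) i" by simp
qed

lemma mono_of_0: "mono_of 0 = (1 :: 't::comm_monoid_add \<Rightarrow>\<^sub>0 'k::comm_ring_1)"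
  by (simp add: mono_of_def)

lemma mono_of_sum:
  "mono_of (\<Sum>j\<in>A. f j) = (\<Prod>j\<in>A. mono_of (f j) :: 't::comm_monoid_add \<Rightarrow>\<^sub>0 'k::comm_ring_1)"
  by (induction A rule: infinite_finite_induct) (simp_all add: mono_of_0 mono_of_add)

lemma mono_of_scaled_sum:
  "mono_of (scaled_sum u a) =
    (\<Prod>j\<in>UNIV. mono_of (u j) ^ Poly_Mapping.lookup a j :: ('n \<Rightarrow>\<^sub>0 nat) \<Rightarrow>\<^sub>0 'k::comm_ring_1)"
  by (simp add: scaled_sum_def mono_of_sum)

lemma scaled_sum_evar_self: "scaled_sum evar p = p"
proof (rule poly_mapping_eqI)
  fix i
  have "Poly_Mapping.lookup (scaled_sum evar p) i =
      (\<Sum>l\<in>UNIV. if l = i then Poly_Mapping.lookup p l else 0)"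
    unfolding lookup_scaled_sum by (rule sum.cong) (simp_all add: lookup_evar)
  then show "Poly_Mapping.lookup (scaled_sum evar p) i = Poly_Mapping.lookup p i" by simp
qed

lemma prod_monom_power:
  "(\<Prod>j\<in>A. monom (c j) (d j) ^ e j) = monom (\<Prod>j\<in>A. c j ^ e j) (\<Sum>j\<in>A. d j * e j)"
  by (induction A rule: infinite_finite_induct) (simp_all add: mult_monom monom_power)

text \<open>The exponents of x and t in the image of x^p y^a in S[t].\<close>

definition rees_weight :: "('m::finite \<Rightarrow> 'n \<Rightarrow>\<^sub>0 nat) \<Rightarrow> ('n \<Rightarrow>\<^sub>0 nat) \<times> ('m \<Rightarrow>\<^sub>0 nat) \<Rightarrow>
    ('n \<Rightarrow>\<^sub>0 nat) \<times> nat"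
  where "rees_weight u = (\<lambda>(p, a). (p + scaled_sum u a, mdeg a))"

lemma rees_weight_add: "rees_weight u (s + t) = rees_weight u s + rees_weight u t"
  by (cases s; cases t) (simp add: rees_weight_def scaled_sum_add mdeg_add ac_simps)

lemma rees_map_eq:
  fixes u :: "'m::finite \<Rightarrow> 'n::finite \<Rightarrow>\<^sub>0 nat" and f :: "('n \<Rightarrow>\<^sub>0 nat) \<times> ('m \<Rightarrow>\<^sub>0 nat) \<Rightarrow>\<^sub>0 'k::field"
  shows "rees_map u f = (\<Sum>(p, a)\<in>Poly_Mapping.keys f.
    monom (Poly_Mapping.single (p + scaled_sum u a) (Poly_Mapping.lookup f (p, a))) (mdeg a))"
  unfolding rees_map_def
proof (rule sum.cong[OF refl], clarify)
  fix p :: "'n \<Rightarrow>\<^sub>0 nat" and a :: "'m \<Rightarrow>\<^sub>0 nat"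
  have "(\<Prod>i\<in>UNIV. [:mono_of (evar i):] ^ Poly_Mapping.lookup p i) = monom (mono_of p :: ('n \<Rightarrow>\<^sub>0 nat) \<Rightarrow>\<^sub>0 'k) 0"
    using prod_monom_power[of "\<lambda>i. mono_of (evar i) :: ('n \<Rightarrow>\<^sub>0 nat) \<Rightarrow>\<^sub>0 'k" "\<lambda>_. 0" "Poly_Mapping.lookup p" UNIV]
      mono_of_scaled_sum[of evar p, where 'k = 'k] by (simp add: scaled_sum_evar_self monom_0)
  moreover have "(\<Prod>j\<in>UNIV. monom (mono_of (u j)) 1 ^ Poly_Mapping.lookup a j) =
      monom (mono_of (scaled_sum u a) :: ('n \<Rightarrow>\<^sub>0 nat) \<Rightarrow>\<^sub>0 'k) (mdeg a)"
    using prod_monom_power[of "\<lambda>j. mono_of (u j) :: ('n \<Rightarrow>\<^sub>0 nat) \<Rightarrow>\<^sub>0 'k" "\<lambda>_. 1" "Poly_Mapping.lookup a" UNIV]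
      mono_of_scaled_sum[of u a, where 'k = 'k] by (simp add: mdeg_def)
  ultimately show "[:Poly_Mapping.single 0 (Poly_Mapping.lookup f (p, a)):] *
      (\<Prod>i\<in>UNIV. [:mono_of (evar i):] ^ Poly_Mapping.lookup p i) *
      (\<Prod>j\<in>UNIV. monom (mono_of (u j)) 1 ^ Poly_Mapping.lookup a j) =
      monom (Poly_Mapping.single (p + scaled_sum u a) (Poly_Mapping.lookup f (p, a))) (mdeg a)"
    by (simp add: monom_0[symmetric] mult_monom mono_of_def mult_single)
qed

text \<open>Monomials map to monomials, so a coefficient of the image collects the coefficients of f
  over one fibre of \<open>rees_weight\<close>.\<close>

lemma rees_kernel_iff:
  "f \<in> rees_kernel u \<longleftrightarrow>
    (\<forall>w. (\<Sum>t\<in>Poly_Mapping.keys f. if rees_weight u t = w then Poly_Mapping.lookup f t else 0) = 0)"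
proof -
  have "Poly_Mapping.lookup (coeff (rees_map u f) d) w =
      (\<Sum>t\<in>Poly_Mapping.keys f. if rees_weight u t = (w, d) then Poly_Mapping.lookup f t else 0)" for w d
    unfolding rees_map_eq coeff_sum lookup_sum
    by (rule sum.cong) (auto simp: rees_weight_def lookup_single when_def split: if_splits)
  then have "rees_map u f = 0 \<longleftrightarrow> (\<forall>d w. (\<Sum>t\<in>Poly_Mapping.keys f.
      if rees_weight u t = (w, d) then Poly_Mapping.lookup f t else 0) = 0)"
    by (simp add: poly_eq_iff poly_mapping_eq_iff fun_eq_iff)
  then show ?thesis by (auto simp: rees_kernel_def)
qed

section \<open>Leading monomials of the Rees ideal\<close>

lemma monomial_order_sharp_lex:
  assumes "monomial_order lt"
  shows "monomial_order (sharp_lex lt :: ('n::linorder \<Rightarrow>\<^sub>0 nat) \<times> 'b::comm_monoid_add \<Rightarrow> _)"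
proof -
  have irrefl: "\<not> lt a a" and trans: "lt a b \<Longrightarrow> lt b c \<Longrightarrow> lt a c"
    and total: "a \<noteq> b \<Longrightarrow> lt a b \<or> lt b a" and zero: "a \<noteq> 0 \<Longrightarrow> lt 0 a"
    and add: "lt a b \<Longrightarrow> lt (a + c) (b + c)" for a b c
    using assms unfolding monomial_order_def by blast+
  have pos: "0 < p" if "p \<noteq> 0" for p :: "'n \<Rightarrow>\<^sub>0 nat"
  proof (rule ccontr)
    assume "\<not> 0 < p"
    then have "p < 0" using that by (simp add: not_less order.order_iff_strict)
    then show False by (simp add: less_poly_mapping.rep_eq less_fun_def)
  qed
  let ?lt = "sharp_lex lt :: ('n \<Rightarrow>\<^sub>0 nat) \<times> 'b \<Rightarrow> _"
  have lt_iff: "?lt s t \<longleftrightarrow> lt (snd s) (snd t) \<or> snd s = snd t \<and> fst s < fst t" for s t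
    by (simp add: sharp_lex_def case_prod_beta)
  show ?thesis unfolding monomial_order_def
  proof (intro conjI allI impI)
    show "\<not> ?lt s s" for s using irrefl by (simp add: lt_iff)
    show "?lt r t" if "?lt r s" "?lt s t" for r s t
      using that trans[of "snd r" "snd s" "snd t"] less_trans[of "fst r" "fst s" "fst t"]
      unfolding lt_iff by fastforce
    show "?lt s t \<or> ?lt t s" if "s \<noteq> t" for s t
      using that total[of "snd s" "snd t"] neq_iff[of "fst s" "fst t"] prod_eq_iff[of s t]
      unfolding lt_iff by fastforce
    show "?lt 0 t" if "t \<noteq> 0" for t
      using that zero[of "snd t"] pos[of "fst t"] prod_eq_iff[of t 0] unfolding lt_iff by auto
    show "?lt (s + r) (t + r)" if "?lt s t" for r s t
      using that add[of "snd s" "snd t" "snd r"] add_strict_right_mono[of "fst s" "fst t" "fst r"]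
      unfolding lt_iff by auto
  qed
qed

lemma lead_mon_props:
  assumes lt: "monomial_order lt" and f: "f \<noteq> 0"
  shows "lead_mon lt f \<in> Poly_Mapping.keys f \<and>
    (\<forall>s\<in>Poly_Mapping.keys f. s \<noteq> lead_mon lt f \<longrightarrow> lt s (lead_mon lt f))"
proof -
  have irrefl: "\<not> lt a a" and trans: "lt a b \<Longrightarrow> lt b c \<Longrightarrow> lt a c"
    and total: "a \<noteq> b \<Longrightarrow> lt a b \<or> lt b a" for a b c
    using lt unfolding monomial_order_def by blast+
  have "\<exists>m\<in>Poly_Mapping.keys f. \<forall>x\<in>Poly_Mapping.keys f. x \<noteq> m \<longrightarrow> \<not> lt m x"
  proof (rule Finite_Set.bex_max_element)
    show "asymp_on (Poly_Mapping.keys f) lt" using irrefl trans by (intro asymp_onI) blast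
    show "transp_on (Poly_Mapping.keys f) lt" using trans by (intro transp_onI) blast
    show "Poly_Mapping.keys f \<noteq> {}" using f by simp
  qed simp
  then obtain m where m: "m \<in> Poly_Mapping.keys f"
    "\<And>s. s \<in> Poly_Mapping.keys f \<Longrightarrow> s \<noteq> m \<Longrightarrow> \<not> lt m s" by blast
  have "lt s m" if "s \<in> Poly_Mapping.keys f" "s \<noteq> m" for s
    using total[OF that(2)] m(2)[OF that] by simp
  then have "\<exists>!m. m \<in> Poly_Mapping.keys f \<and> (\<forall>s\<in>Poly_Mapping.keys f. s \<noteq> m \<longrightarrow> lt s m)"
  proof (intro ex1I[of _ m] conjI ballI impI)
    fix m' assume m': "m' \<in> Poly_Mapping.keys f \<and> (\<forall>s\<in>Poly_Mapping.keys f. s \<noteq> m' \<longrightarrow> lt s m')"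
    show "m' = m"
    proof (rule ccontr)
      assume "m' \<noteq> m"
      then have "\<not> lt m m'" "lt m m'" using m m' by auto
      then show False by simp
    qed
  qed (use m in auto)
  then show ?thesis unfolding lead_mon_def by (rule theI')
qed

text \<open>The exponents of the monomials of \<open>in(J)\<close>, because \<open>J\<close> is spanned by the binomials
  \<open>x^p y^a - x^q y^b\<close> with equal images in the Rees algebra.\<close>

definition rees_initial :: "(('n \<Rightarrow>\<^sub>0 nat) \<times> ('m \<Rightarrow>\<^sub>0 nat) \<Rightarrow> _ \<Rightarrow> bool) \<Rightarrow> ('m::finite \<Rightarrow> 'n \<Rightarrow>\<^sub>0 nat) \<Rightarrow>
    (('n \<Rightarrow>\<^sub>0 nat) \<times> ('m \<Rightarrow>\<^sub>0 nat)) set"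
  where "rees_initial lt u = {t. \<exists>s. lt s t \<and> rees_weight u s = rees_weight u t}"

lemma rees_initial_add:
  assumes "monomial_order lt" "t \<in> rees_initial lt u"
  shows "t + r \<in> rees_initial lt u"
proof -
  obtain s where s: "lt s t" "rees_weight u s = rees_weight u t"
    using assms(2) by (auto simp: rees_initial_def)
  then have "lt (s + r) (t + r)" using assms(1) unfolding monomial_order_def by blast
  moreover have "rees_weight u (s + r) = rees_weight u (t + r)" using s by (simp add: rees_weight_add)
  ultimately show ?thesis unfolding rees_initial_def by blast
qed

text \<open>The coefficients over the fibre of the leading monomial sum to zero while the leading
  one is nonzero, so the fibre contains another, smaller monomial of f.\<close>

lemma lead_mon_rees_kernel:
  assumes lt: "monomial_order lt" and f: "f \<in> rees_kernel u" "f \<noteq> 0"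
  shows "lead_mon lt f \<in> rees_initial lt u"
proof -
  let ?t = "lead_mon lt f" and ?K = "Poly_Mapping.keys f"
  let ?h = "\<lambda>t. if rees_weight u t = rees_weight u ?t then Poly_Mapping.lookup f t else 0"
  have t: "?t \<in> ?K" "\<And>s. s \<in> ?K \<Longrightarrow> s \<noteq> ?t \<Longrightarrow> lt s ?t" using lead_mon_props[OF lt f(2)] by blast+
  have "sum ?h ?K = 0" using f(1) unfolding rees_kernel_iff by blast
  then have "?h ?t + sum ?h (?K - {?t}) = 0" using t(1) by (simp add: sum.remove)
  moreover have "?h ?t \<noteq> 0" using t(1) by (simp add: in_keys_iff)
  ultimately have "sum ?h (?K - {?t}) \<noteq> 0" by auto
  then obtain s where "s \<in> ?K - {?t}" "?h s \<noteq> 0" by (rule sum.not_neutral_contains_not_neutral)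
  then have "lt s ?t" "rees_weight u s = rees_weight u ?t" using t(2) by (auto split: if_splits)
  then show ?thesis unfolding rees_initial_def by blast
qed

text \<open>One direction is \<open>lead_mon_rees_kernel\<close> with closure under multiples;
  conversely, t is the leading monomial of the binomial \<open>mono_of t - mono_of s\<close> in
  J.\<close>

lemma mono_of_in_initial_ideal_iff:
  fixes u :: "'m::finite \<Rightarrow> 'n::finite \<Rightarrow>\<^sub>0 nat"
  defines "K \<equiv> rees_kernel u :: (('n \<Rightarrow>\<^sub>0 nat) \<times> ('m \<Rightarrow>\<^sub>0 nat) \<Rightarrow>\<^sub>0 'k::field) set"
  assumes lt: "monomial_order lt"
  shows "mono_of t \<in> initial_ideal lt K \<longleftrightarrow> t \<in> rees_initial lt u"
proof -
  have eq: "{mono_of (lead_mon lt f) | f. f \<in> K \<and> f \<noteq> 0} =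
      mono_of ` (lead_mon lt ` {f. f \<in> K \<and> f \<noteq> 0})"
    by blast
  have "(\<exists>f. f \<in> K \<and> f \<noteq> 0 \<and> mdvd (lead_mon lt f) t) \<longleftrightarrow> t \<in> rees_initial lt u"
  proof
    assume "\<exists>f. f \<in> K \<and> f \<noteq> 0 \<and> mdvd (lead_mon lt f) t"
    then obtain f r where "f \<in> K" "f \<noteq> 0" "t = lead_mon lt f + r"
      unfolding mdvd_def by blast
    then show "t \<in> rees_initial lt u"
      using rees_initial_add[OF lt lead_mon_rees_kernel[OF lt]] unfolding K_def by blast
  next
    assume "t \<in> rees_initial lt u"
    then obtain s where s: "lt s t" "rees_weight u s = rees_weight u t" by (auto simp: rees_initial_def)
    have irrefl: "\<not> lt a a" and asym: "lt a b \<Longrightarrow> \<not> lt b a" for a b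
      using lt unfolding monomial_order_def by blast+
    let ?f = "mono_of t - mono_of s :: ('n \<Rightarrow>\<^sub>0 nat) \<times> ('m \<Rightarrow>\<^sub>0 nat) \<Rightarrow>\<^sub>0 'k"
    have "s \<noteq> t" using s(1) irrefl by blast
    then have lookup: "Poly_Mapping.lookup ?f r = (if r = t then 1 else if r = s then - 1 else 0)" for r
      by (auto simp: lookup_minus mono_of_def lookup_single when_def)
    then have keys: "Poly_Mapping.keys ?f = {t, s}" by (auto simp: in_keys_iff split: if_splits)
    have "?f \<in> K"
      unfolding K_def rees_kernel_iff keys using s(2) \<open>s \<noteq> t\<close> by (auto simp: lookup)
    moreover have "?f \<noteq> 0" using keys by force
    moreover have "lead_mon lt ?f = t"
    proof -
      have "lead_mon lt ?f \<in> {t, s}" "t \<noteq> lead_mon lt ?f \<Longrightarrow> lt t (lead_mon lt ?f)"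
        using lead_mon_props[OF lt \<open>?f \<noteq> 0\<close>] unfolding keys by (simp, force)
      then show ?thesis using asym[OF s(1)] by (metis insertE singletonD)
    qed
    ultimately show "\<exists>f. f \<in> K \<and> f \<noteq> 0 \<and> mdvd (lead_mon lt f) t"
      using mdvd_refl[of t] by (intro exI[of _ ?f]) simp
  qed
  then show ?thesis unfolding initial_ideal_def eq mono_in_ideal_gen_iff by auto
qed

text \<open>A leading monomial of the Groebner basis divides x^p y^a and has x-degree 0 or 1;
  multiplying it by a monomial in the y_j restores y^a.\<close>

lemma x_condition_linear:
  fixes u :: "'m::finite \<Rightarrow> 'n::{finite,linorder} \<Rightarrow>\<^sub>0 nat"
  assumes lt: "monomial_order lt" and x: "x_condition lt (rees_kernel u :: (_ \<Rightarrow>\<^sub>0 'k::field) set)"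
    and pa: "(p, a) \<in> rees_initial (sharp_lex lt) u"
  shows "(0, a) \<in> rees_initial (sharp_lex lt) u \<or>
    (\<exists>i. Poly_Mapping.lookup p i \<noteq> 0 \<and> (evar i, a) \<in> rees_initial (sharp_lex lt) u)"
proof -
  have order: "monomial_order (sharp_lex lt :: ('n \<Rightarrow>\<^sub>0 nat) \<times> _ \<Rightarrow> _)"
    using lt by (rule monomial_order_sharp_lex)
  obtain B :: "(_ \<Rightarrow>\<^sub>0 'k) set" where gb: "reduced_groebner_basis (sharp_lex lt) (rees_kernel u) B"
    and lin: "\<forall>g\<in>B. \<forall>(q, b)\<in>Poly_Mapping.keys g. mdeg q \<le> 1"
    using x unfolding x_condition_def by (elim exE conjE)
  have B: "0 \<notin> B" "B \<subseteq> rees_kernel u"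
      "ideal_gen {mono_of (lead_mon (sharp_lex lt) g) | g. g \<in> B} =
        initial_ideal (sharp_lex lt) (rees_kernel u :: (_ \<Rightarrow>\<^sub>0 'k) set)"
    using gb by (simp_all add: reduced_groebner_basis_def groebner_basis_def)
  have eq: "{mono_of (lead_mon (sharp_lex lt) g) | g. g \<in> B} =
      (mono_of ` (lead_mon (sharp_lex lt) ` B) :: (_ \<Rightarrow>\<^sub>0 'k) set)" by blast
  have "(mono_of (p, a) :: _ \<Rightarrow>\<^sub>0 'k) \<in> initial_ideal (sharp_lex lt) (rees_kernel u)"
    using pa mono_of_in_initial_ideal_iff[OF order] by blast
  then obtain g where g: "g \<in> B" "mdvd (lead_mon (sharp_lex lt) g) (p, a)"
    unfolding B(3)[symmetric] eq mono_in_ideal_gen_iff by blast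
  obtain q b where qb: "lead_mon (sharp_lex lt) g = (q, b)" by fastforce
  have "g \<noteq> 0" using g(1) B(1) by blast
  then have "(q, b) \<in> Poly_Mapping.keys g" using lead_mon_props[OF order] qb by metis
  then have deg: "mdeg q \<le> 1" using lin g(1) by blast
  have init: "(q, b) \<in> rees_initial (sharp_lex lt) u"
    using lead_mon_rees_kernel[OF order _ \<open>g \<noteq> 0\<close>] g(1) B(2) qb by (metis subsetD)
  have dvd: "mdvd q p" "mdvd b a" using g(2) by (simp_all add: qb mdvd_prod_iff)
  then obtain r where "a = b + r" unfolding mdvd_def by blast
  then have qa: "(q, a) \<in> rees_initial (sharp_lex lt) u"
    using rees_initial_add[OF order init, of "(0, r)"] by simp
  have "mdeg q = 0 \<or> mdeg q = 1" using deg by linarith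
  then show ?thesis
  proof
    assume "mdeg q = 0"
    then show ?thesis using qa by (simp add: mdeg_eq_0_iff)
  next
    assume "mdeg q = 1"
    then obtain i where i: "q = evar i" using mdeg_eq_1 by blast
    then have "Poly_Mapping.lookup p i \<noteq> 0" using dvd(1) unfolding i evar_mdvd_iff by simp
    then show ?thesis using qa unfolding i by (intro disjI2 exI conjI)
  qed
qed


section \<open>Linear quotients of the powers\<close>

lemma finite_mdeg_eq: "finite {a :: 'm::finite \<Rightarrow>\<^sub>0 nat. mdeg a = k}"
proof (rule finite_subset[OF _ finite_box])
  show "{a :: 'm \<Rightarrow>\<^sub>0 nat. mdeg a = k} \<subseteq> {p. \<forall>i. Poly_Mapping.lookup p i \<le> k}"
    by (auto simp: mdeg_def intro: member_le_sum)
qed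

text \<open>For D all exponents of degree k this describes I^k; initial segments D give the steps of
  its filtration.\<close>

definition monos_of_power :: "('m::finite \<Rightarrow> 'n \<Rightarrow>\<^sub>0 nat) \<Rightarrow> ('m \<Rightarrow>\<^sub>0 nat) set \<Rightarrow> ('n \<Rightarrow>\<^sub>0 nat) set"
  where "monos_of_power u D = {t. \<exists>a\<in>D. mdvd (scaled_sum u a) t}"

lemma mult_closed_monos_of_power: "mult_closed (monos_of_power u D)"
  unfolding mult_closed_def monos_of_power_def mdvd_def
  by (clarify, intro bexI exI) (simp_all add: add.assoc)

text \<open>Linear quotients: \<open>u^a\<close>, added in the order of the \<open>y^a\<close>, has \<open>x^p u^a\<close> in the ideal of its predecessors
  iff \<open>x^p y^a \<in> in(J)\<close>, and by the x-condition these \<open>x^p\<close> form an ideal generated by variables.\<close>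

lemma rseq_monos_of_power:
  fixes u :: "'m::finite \<Rightarrow> 'n::{finite,linorder} \<Rightarrow>\<^sub>0 nat"
    and lt :: "('m \<Rightarrow>\<^sub>0 nat) \<Rightarrow> ('m \<Rightarrow>\<^sub>0 nat) \<Rightarrow> bool"
  defines "E \<equiv> rees_initial (sharp_lex lt) u"
  assumes lt: "monomial_order lt"
    and lin: "\<And>p a. (p, a) \<in> E \<Longrightarrow>
      (0, a) \<in> E \<or> (\<exists>i. Poly_Mapping.lookup p i \<noteq> 0 \<and> (evar i, a) \<in> E)"
    and s: "\<And>a. mdeg a = k \<Longrightarrow> (0, a) \<notin> E \<Longrightarrow> s \<le> card {i. (evar i, a) \<notin> E}"
  shows "D \<subseteq> {a. mdeg a = k} \<Longrightarrow> (\<And>a b. a \<in> D \<Longrightarrow> mdeg b = k \<Longrightarrow> lt b a \<Longrightarrow> b \<in> D) \<Longrightarrow>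
    rseq (mon_span (monos_of_power u D) :: (('n \<Rightarrow>\<^sub>0 nat) \<Rightarrow>\<^sub>0 'k::comm_ring_1) set) 0 (esyms s)"
proof (induction "card D" arbitrary: D rule: less_induct)
  case less
  let ?lt = "sharp_lex lt :: ('n \<Rightarrow>\<^sub>0 nat) \<times> ('m \<Rightarrow>\<^sub>0 nat) \<Rightarrow> _"
  let ?I = "\<lambda>D. mon_span (monos_of_power u D) :: (('n \<Rightarrow>\<^sub>0 nat) \<Rightarrow>\<^sub>0 'k) set"
  have irrefl: "\<not> lt a a" and trans: "lt a b \<Longrightarrow> lt b c \<Longrightarrow> lt a c"
    and total: "a \<noteq> b \<Longrightarrow> lt a b \<or> lt b a" for a b c
    using lt unfolding monomial_order_def by blast+
  have fin: "finite D" using less.prems(1) finite_mdeg_eq by (rule finite_subset)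
  show ?case
  proof (cases "D = {}")
    case True
    then have "?I D = 0" by (auto simp: monos_of_power_def mon_span_def set_zero)
    then show ?thesis using rseq_self[OF is_ideal_set_zero] by simp
  next
    case False
    have "\<exists>m\<in>D. \<forall>x\<in>D. x \<noteq> m \<longrightarrow> \<not> lt m x"
    proof (rule Finite_Set.bex_max_element[OF fin _ _ False])
      show "asymp_on D lt" using irrefl trans by (intro asymp_onI) blast
      show "transp_on D lt" using trans by (intro transp_onI) blast
    qed
    then obtain b where b: "b \<in> D" "\<And>x. x \<in> D \<Longrightarrow> x \<noteq> b \<Longrightarrow> \<not> lt b x" by blast
    let ?D = "D - {b}"
    \<comment> \<open>D is closed downwards in degree k and b is its largest element, so exactly the
      predecessors of b remain.\<close>
    have below: "x \<in> ?D \<longleftrightarrow> mdeg x = k \<and> lt x b" for x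
      using b less.prems irrefl total[of x b] by blast
    have kb: "mdeg b = k" using b(1) less.prems(1) by blast
    have IH: "rseq (?I ?D) 0 (esyms s)"
    proof (rule less.hyps)
      show "card ?D < card D" using fin b(1) by (rule card_Diff1_less)
      show "?D \<subseteq> {a. mdeg a = k}" using less.prems(1) by blast
      show "c \<in> ?D" if "a \<in> ?D" "mdeg c = k" "lt c a" for a c
        using that trans unfolding below by blast
    qed
    have colon: "scaled_sum u b + t \<in> monos_of_power u ?D \<longleftrightarrow> (t, b) \<in> E" for t
    proof
      assume "scaled_sum u b + t \<in> monos_of_power u ?D"
      then obtain a where a: "a \<in> ?D" "mdvd (scaled_sum u a) (scaled_sum u b + t)"
        unfolding monos_of_power_def by blast
      then obtain q where q: "scaled_sum u b + t = scaled_sum u a + q" unfolding mdvd_def by blast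
      have "?lt (q, a) (t, b)" using a(1) unfolding below by (simp add: sharp_lex_def)
      moreover have "rees_weight u (q, a) = rees_weight u (t, b)"
        using a(1) kb q unfolding below by (simp add: rees_weight_def add.commute)
      ultimately show "(t, b) \<in> E" unfolding E_def rees_initial_def by blast
    next
      assume "(t, b) \<in> E"
      then obtain q a where qa: "?lt (q, a) (t, b)" "rees_weight u (q, a) = rees_weight u (t, b)"
        unfolding E_def rees_initial_def by auto
      have w: "q + scaled_sum u a = t + scaled_sum u b" "mdeg a = mdeg b"
        using qa(2) by (simp_all add: rees_weight_def)
      \<comment> \<open>The tie a = b is impossible: equal weights would then force q = t, against q
        < t.\<close>
      have "lt a b"
        using qa(1) w(1) by (auto simp: sharp_lex_def)
      then have "a \<in> ?D" using w(2) kb below by simp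
      moreover have "mdvd (scaled_sum u a) (scaled_sum u b + t)"
        unfolding mdvd_def using w(1) by (metis add.commute)
      ultimately show "scaled_sum u b + t \<in> monos_of_power u ?D" unfolding monos_of_power_def by blast
    qed
    have insert: "monos_of_power u D = monos_of_power u ?D \<union> range ((+) (scaled_sum u b))"
      using b(1) by (auto simp: monos_of_power_def mdvd_def)
    show ?thesis
    \<comment> \<open>If y^b lies in in(J), then \<open>u^b\<close> is already a multiple of an
      earlier product and the ideal does not grow.\<close>
    proof (cases "(0, b) \<in> E")
      case True
      then have "scaled_sum u b \<in> monos_of_power u ?D" using colon[of 0] by simp
      then have "range ((+) (scaled_sum u b)) \<subseteq> monos_of_power u ?D"
        using mult_closed_monos_of_power[of u ?D] by (auto simp: mult_closed_def)
      then have "monos_of_power u D = monos_of_power u ?D" using insert by blast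
      then show ?thesis using IH by simp
    next
      case False
      let ?Q = "{i. (evar i, b) \<in> E}"
      have "{t. scaled_sum u b + t \<in> monos_of_power u ?D} = coord ?Q"
      proof -
        have "(t, b) \<in> E" if ti: "Poly_Mapping.lookup t i \<noteq> 0" "(evar i, b) \<in> E" for t i
        proof -
          obtain r where "t = evar i + r" using ti(1) evar_mdvd_iff[of i t] unfolding mdvd_def by blast
          then show ?thesis
            using rees_initial_add[OF monomial_order_sharp_lex[OF lt], of "(evar i, b)" u "(r, 0)"] ti(2)
            by (simp add: E_def)
        qed
        then show ?thesis unfolding colon coord_def using lin[of _ b] False by blast
      qed
      moreover have "- ?Q = {i. (evar i, b) \<notin> E}" by blast
      then have "rseq UNIV (mon_span (coord ?Q) :: (('n \<Rightarrow>\<^sub>0 nat) \<Rightarrow>\<^sub>0 'k) set) (esyms s)"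
        using s[OF kb False] by (intro rseq_coord) simp_all
      ultimately have step: "rseq (?I D) (?I ?D) (esyms s)"
        unfolding insert using rseq_adjoin_mono[OF mult_closed_monos_of_power] by metis
      have sub: "?I ?D \<subseteq> ?I D" unfolding insert mon_span_def by blast
      have ideal: "is_ideal (?I D)" for D by (rule is_ideal_mon_span[OF mult_closed_monos_of_power])
      have "0 \<subseteq> ?I ?D" using ideals.subspace_0[OF ideal] by (simp add: set_zero)
      then show ?thesis by (rule rseq_extension[OF ideal ideal is_ideal_set_zero _ sub IH step])
    qed
  qed
qed

section \<open>Powers of I and their depth\<close>

lemma ideal_pow_monos_of_power:
  fixes u :: "'m::finite \<Rightarrow> 'n::finite \<Rightarrow>\<^sub>0 nat" and I :: "(('n \<Rightarrow>\<^sub>0 nat) \<Rightarrow>\<^sub>0 'k::field) set"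
  assumes I: "I = mon_span {t. \<exists>j. mdvd (u j) t}"
  shows "ideal_pow I k = mon_span (monos_of_power u {a. mdeg a = k})"
proof (induction k)
  case 0
  have "mdvd 0 t" for t :: "'n \<Rightarrow>\<^sub>0 nat" unfolding mdvd_def by simp
  then show ?case by (simp add: mdeg_eq_0_iff monos_of_power_def mon_span_def)
next
  case (Suc k)
  let ?T = "monos_of_power u {a. mdeg a = k}" and ?U = "monos_of_power u {a. mdeg a = Suc k}"
  let ?P = "{f * g | f g. f \<in> I \<and> g \<in> (mon_span ?T :: (('n \<Rightarrow>\<^sub>0 nat) \<Rightarrow>\<^sub>0 'k) set)}"
  have prod: "f * g \<in> mon_span ?U" if f: "f \<in> I" and g: "g \<in> mon_span ?T"
    for f g :: "('n \<Rightarrow>\<^sub>0 nat) \<Rightarrow>\<^sub>0 'k"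
  proof -
    have "t \<in> ?U" if t: "t \<in> Poly_Mapping.keys (f * g)" for t
    proof -
      obtain x y where xy: "t = x + y" "x \<in> Poly_Mapping.keys f" "y \<in> Poly_Mapping.keys g"
        using t keys_mult[of f g] by blast
      obtain j r where j: "x = u j + r" using f xy(2) unfolding I mon_span_def mdvd_def by blast
      obtain a q where a: "mdeg a = k" "y = scaled_sum u a + q"
        using g xy(3) unfolding monos_of_power_def mon_span_def mdvd_def by blast
      have "t = scaled_sum u (evar j + a) + (r + q)"
        by (simp add: xy(1) j a(2) scaled_sum_add scaled_sum_evar ac_simps)
      moreover have "mdeg (evar j + a) = Suc k" by (simp add: mdeg_add a(1))
      ultimately show ?thesis unfolding monos_of_power_def mdvd_def by blast
    qed
    then show ?thesis unfolding mon_span_def by blast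
  qed
  have "ideal_gen ?P = mon_span ?U"
  proof
    show "ideal_gen ?P \<subseteq> mon_span ?U"
      using prod by (intro ideals.span_minimal is_ideal_mon_span mult_closed_monos_of_power) auto
    show "mon_span ?U \<subseteq> ideal_gen ?P"
    proof (rule mon_span_subset)
      show "is_ideal (ideal_gen ?P)" by (rule ideals.subspace_span)
      fix t assume "t \<in> ?U"
      then obtain a q where a: "mdeg a = Suc k" "t = scaled_sum u a + q"
        unfolding monos_of_power_def mdvd_def by blast
      then have "a \<noteq> 0" by auto
      then obtain j where "Poly_Mapping.lookup a j \<noteq> 0"
        using poly_mapping_eqI[of a 0] by (metis lookup_zero)
      then obtain b where b: "a = evar j + b" using evar_mdvd_iff[of j a] unfolding mdvd_def by blast
      then have "mdeg b = k" using a(1) by (simp add: mdeg_add)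
      then have "scaled_sum u b + q \<in> ?T" unfolding monos_of_power_def mdvd_def by blast
      moreover have "mono_of (u j) \<in> I" unfolding I using mdvd_refl by auto
      ultimately have "mono_of (u j) * mono_of (scaled_sum u b + q) \<in> ?P"
        unfolding mem_Collect_eq by (metis mono_of_in_mon_span)
      moreover have "t = u j + (scaled_sum u b + q)"
        by (simp add: a(2) b scaled_sum_add scaled_sum_evar ac_simps)
      ultimately show "mono_of t \<in> ideal_gen ?P" by (simp only: mono_of_add ideals.span_base)
    qed
  qed
  then show ?case by (simp add: Suc.IH)
qed

lemma monomial_ideal_eq:
  fixes u :: "'m::finite \<Rightarrow> 'n::finite \<Rightarrow>\<^sub>0 nat" and I :: "(('n \<Rightarrow>\<^sub>0 nat) \<Rightarrow>\<^sub>0 'k::field) set"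
  assumes I: "monomial_ideal I" and u: "range u = min_gens I"
  shows "I = mon_span {t. \<exists>j. mdvd (u j) t}"
proof -
  obtain B where B: "I = mon_span {t. \<exists>s\<in>B. mdvd s t}"
    using I unfolding monomial_ideal_def ideal_gen_mono_of by blast
  have "(\<exists>s\<in>B. mdvd s t) \<longleftrightarrow> (\<exists>j. mdvd (u j) t)" for t
  proof
    assume "\<exists>s\<in>B. mdvd s t"
    then have "mono_of t \<in> I" unfolding B by simp
    then obtain s where "s \<in> min_gens I" "mdvd s t" using min_gens_dvd[of mdeg, OF mdvd_mdeg_less] by blast
    then show "\<exists>j. mdvd (u j) t" using u by (metis imageE)
  next
    assume "\<exists>j. mdvd (u j) t"
    then obtain j where j: "mdvd (u j) t" by blast
    have "u j \<in> min_gens I" using u by blast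
    then have "mono_of (u j) \<in> I" unfolding min_gens_def by blast
    then have "\<exists>s\<in>B. mdvd s (u j)" unfolding B by simp
    then show "\<exists>s\<in>B. mdvd s t" using j mdvd_trans by blast
  qed
  then show ?thesis unfolding B by simp
qed

text \<open>I^k carries n - r regular elements and S/I^k loses one. The bound r is asked only where
  y^a lies outside in(J), which is the form that (b) can supply.\<close>

lemma depth_quot_ideal_pow_ge:
  fixes u :: "'m::finite \<Rightarrow> 'n::{finite,linorder} \<Rightarrow>\<^sub>0 nat"
    and I :: "(('n \<Rightarrow>\<^sub>0 nat) \<Rightarrow>\<^sub>0 'k::field) set"
    and lt :: "('m \<Rightarrow>\<^sub>0 nat) \<Rightarrow> ('m \<Rightarrow>\<^sub>0 nat) \<Rightarrow> bool"
  defines "E \<equiv> rees_initial (sharp_lex lt) u"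
  assumes I: "monomial_ideal I" "I \<noteq> UNIV" and u: "range u = min_gens I"
    and lt: "monomial_order lt" and x: "x_condition lt (rees_kernel u :: (_ \<Rightarrow>\<^sub>0 'k) set)"
    and k: "1 \<le> k"
    and r: "\<And>a. mdeg a = k \<Longrightarrow> (0, a) \<notin> E \<Longrightarrow> card {i. (evar i, a) \<in> E} \<le> r"
  shows "enat CARD('n) \<le> depth_quot (ideal_pow I k) + enat r + 1"
proof (cases "CARD('n) \<le> r + 1")
  case True
  then have "enat CARD('n) \<le> enat r + 1" by (simp add: one_enat_def)
  also have "\<dots> \<le> depth_quot (ideal_pow I k) + enat r + 1" by (simp add: add_increasing)
  finally show ?thesis .
next
  case False
  define s where "s = CARD('n) - r - 1"
  have s: "Suc s = CARD('n) - r" "CARD('n) = s + r + 1" using False by (simp_all add: s_def)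
  let ?A = "{a :: 'm \<Rightarrow>\<^sub>0 nat. mdeg a = k}"
  let ?T = "monos_of_power u ?A"
  have I_eq: "I = mon_span {t. \<exists>j. mdvd (u j) t}" using I(1) u by (rule monomial_ideal_eq)
  have "enat s \<le> depth_quot (mon_span ?T :: (('n \<Rightarrow>\<^sub>0 nat) \<Rightarrow>\<^sub>0 'k) set)"
  proof (rule depth_quot_mon_span_ge)
    show "mult_closed ?T" by (rule mult_closed_monos_of_power)
    \<comment> \<open>Any common bound for the exponents of the generators will do; the sum of their
      degrees is one.\<close>
    define N where "N = (\<Sum>a\<in>?A. mdeg (scaled_sum u a))"
    have "Poly_Mapping.lookup (scaled_sum u a) i \<le> N" if "a \<in> ?A" for a i
    proof -
      have "Poly_Mapping.lookup (scaled_sum u a) i \<le> mdeg (scaled_sum u a)"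
        unfolding mdeg_def by (rule member_le_sum) simp_all
      also have "\<dots> \<le> N" unfolding N_def using that finite_mdeg_eq by (intro member_le_sum) simp_all
      finally show ?thesis .
    qed
    then have "capped N {t. \<exists>s\<in>scaled_sum u ` ?A. mdvd s t}" by (intro capped_multiples) auto
    then show "capped N ?T" by (simp add: monos_of_power_def)
    show "0 \<notin> ?T"
    proof
      assume "0 \<in> ?T"
      then obtain a where a: "mdeg a = k" "mdvd (scaled_sum u a) 0" unfolding monos_of_power_def by blast
      then have "a \<noteq> 0" using k by auto
      \<comment> \<open>As k is positive, some \<open>u j\<close> divides \<open>u^a\<close>; if
        \<open>u^a\<close> were 1, then I would contain 1.\<close>
      then obtain j where "Poly_Mapping.lookup a j \<noteq> 0"
        using poly_mapping_eqI[of a 0] by (metis lookup_zero)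
      then obtain b where "a = evar j + b" using evar_mdvd_iff[of j a] unfolding mdvd_def by blast
      then have "mdvd (u j) (scaled_sum u a)"
        by (auto simp: scaled_sum_add scaled_sum_evar mdvd_def)
      then have "mdvd (u j) 0" using a(2) by (rule mdvd_trans)
      then have "mdvd (u j) t" for t by (simp add: mdvd_iff)
      then have "I = UNIV" unfolding I_eq mon_span_def by blast
      then show False using I(2) by simp
    qed
    show "s \<le> CARD('n)" using s by simp
    show "rseq (mon_span ?T) (0 :: (('n \<Rightarrow>\<^sub>0 nat) \<Rightarrow>\<^sub>0 'k) set) (esyms (Suc s))"
    proof (rule rseq_monos_of_power[OF lt])
      show "(0, a) \<in> rees_initial (sharp_lex lt) u \<or>
          (\<exists>i. Poly_Mapping.lookup p i \<noteq> 0 \<and> (evar i, a) \<in> rees_initial (sharp_lex lt) u)"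
        if "(p, a) \<in> rees_initial (sharp_lex lt) u" for p a
        using lt x that by (rule x_condition_linear)
      show "Suc s \<le> card {i. (evar i, a) \<notin> rees_initial (sharp_lex lt) u}"
        if "mdeg a = k" "(0, a) \<notin> rees_initial (sharp_lex lt) u" for a
      proof -
        have "{i. (evar i, a) \<notin> E} = - {i. (evar i, a) \<in> E}" by blast
        then have "card {i. (evar i, a) \<notin> E} = CARD('n) - card {i. (evar i, a) \<in> E}"
          by (simp add: Compl_eq_Diff_UNIV card_Diff_subset)
        then show ?thesis using r[of a] that s(1) by (simp add: E_def)
      qed
    qed auto
  qed
  then have "enat s + enat r + 1 \<le> depth_quot (ideal_pow I k) + enat r + 1"
    unfolding ideal_pow_monos_of_power[OF I_eq] by (intro add_right_mono)
  then show ?thesis unfolding s(2) by (simp add: one_enat_def)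
qed

theorem corollary2p6:
  fixes I :: "(('n::{finite,linorder} \<Rightarrow>\<^sub>0 nat) \<Rightarrow>\<^sub>0 'k::field) set"
    and u :: "'m::finite \<Rightarrow> 'n \<Rightarrow>\<^sub>0 nat"
    and less_sharp :: "('m \<Rightarrow>\<^sub>0 nat) \<Rightarrow> ('m \<Rightarrow>\<^sub>0 nat) \<Rightarrow> bool"
    and J inJ :: "(('n \<Rightarrow>\<^sub>0 nat) \<times> ('m \<Rightarrow>\<^sub>0 nat) \<Rightarrow>\<^sub>0 'k) set"
    and c :: "'m \<Rightarrow>\<^sub>0 nat"
  assumes "monomial_ideal I" and "I \<noteq> {0}" and "I \<noteq> UNIV"
    and "\<exists>d. \<forall>t\<in>min_gens I. mdeg t = d"
    and "bij_betw u UNIV (min_gens I)"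
    and "monomial_order less_sharp"
    and J: "J = rees_kernel u"
    and "x_condition less_sharp J"
    and inJ: "inJ = initial_ideal (sharp_lex less_sharp) J"
    and "is_mlcm c {a. \<exists>i. (evar i, a) \<in> min_gens inJ}"
  shows "(\<forall>k\<ge>1. enat CARD('n) \<le>
        depth_quot (ideal_pow I k) + enat (Max (rho inJ ` {a. mdeg a = k})) + 1) \<and>
    ((\<forall>\<^sub>F k in sequentially. enat CARD('n) \<le> depth_quot (ideal_pow I k) + enat (rho inJ c) + 1) \<and>
     (\<forall>d. (\<forall>\<^sub>F k in sequentially. depth_quot (ideal_pow I k) = d) \<longrightarrow>
        enat CARD('n) \<le> d + enat (rho inJ c) + 1))"
proof -
  let ?E = "rees_initial (sharp_lex less_sharp) u"
  have order: "monomial_order (sharp_lex less_sharp :: ('n \<Rightarrow>\<^sub>0 nat) \<times> _ \<Rightarrow> _)"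
    using assms(6) by (rule monomial_order_sharp_lex)
  have mem: "mono_of t \<in> inJ \<longleftrightarrow> t \<in> ?E" for t
    unfolding inJ J by (rule mono_of_in_initial_ideal_iff[OF order])
  have rho: "rho inJ a = card {i. (evar i, a) \<in> ?E}" for a
    by (simp add: rho_def mem)
  have "range u = min_gens I" using assms(5) by (simp add: bij_betw_def)
  note depth = depth_quot_ideal_pow_ge[OF assms(1,3) this assms(6) assms(8)[unfolded J], folded rho]
  have a: "enat CARD('n) \<le>
      depth_quot (ideal_pow I k) + enat (Max (rho inJ ` {a. mdeg a = k})) + 1" if "1 \<le> k" for k
    using that by (rule depth) (auto intro!: Max_ge simp: finite_mdeg_eq)
  \<comment> \<open>A minimal generator dividing x_i y^a must involve x_i, because y^a lies outside
    in(J). Its y-part therefore divides y^c, and x_i y^c lies in in(J) too.\<close>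
  have "rho inJ a \<le> rho inJ c" if std: "(0, a) \<notin> ?E" for a
  proof -
    have "(evar i, c) \<in> ?E" if i: "(evar i, a) \<in> ?E" for i
    proof -
      have size: "mdeg (fst s) + mdeg (snd s) < mdeg (fst t) + mdeg (snd t)"
        if st: "mdvd s t" "s \<noteq> t" for s t :: "('n \<Rightarrow>\<^sub>0 nat) \<times> ('m \<Rightarrow>\<^sub>0 nat)"
      proof -
        obtain r where r: "t = s + r" "r \<noteq> 0" using st unfolding mdvd_def by force
        then have "mdeg (fst r) + mdeg (snd r) \<noteq> 0" by (auto simp: mdeg_eq_0_iff prod_eq_iff)
        then show ?thesis by (simp add: r(1) mdeg_add)
      qed
      have "\<exists>s\<in>min_gens inJ. mdvd s (evar i, a)"
        using i mem by (intro min_gens_dvd[of "\<lambda>s. mdeg (fst s) + mdeg (snd s)", OF size]) blast+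
      then obtain p b where pb: "(p, b) \<in> min_gens inJ" "mdvd p (evar i)" "mdvd b a"
        using mdvd_prod_iff by fastforce
      have "(p, b) \<in> ?E" using pb(1) mem unfolding min_gens_def by blast
      have lift: "(p, d) \<in> ?E" if bd: "mdvd b d" for d
      proof -
        obtain r where "d = b + r" using bd unfolding mdvd_def by blast
        then show ?thesis using rees_initial_add[OF order \<open>(p, b) \<in> ?E\<close>, of "(0, r)"] by simp
      qed
      \<comment> \<open>With p = 0 the generator would put y^a itself into in(J).\<close>
      have "p \<noteq> 0" using lift[OF pb(3)] std by blast
      then have "p = evar i" using mdvd_mdeg_less[OF pb(2)] by (auto simp: mdeg_eq_0_iff)
      then have "mdvd b c" using assms(10) pb(1) unfolding is_mlcm_def by blast
      then show ?thesis using lift \<open>p = evar i\<close> by blast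
    qed
    then show ?thesis unfolding rho by (intro card_mono) auto
  qed
  \<comment> \<open>This bound holds for every positive k, so it passes to the eventual value of the
    depth.\<close>
  then have b: "enat CARD('n) \<le> depth_quot (ideal_pow I k) + enat (rho inJ c) + 1" if "1 \<le> k" for k
    using that by (intro depth) auto
  then have ev: "\<forall>\<^sub>F k in sequentially.
      enat CARD('n) \<le> depth_quot (ideal_pow I k) + enat (rho inJ c) + 1"
    by (rule eventually_sequentiallyI)
  have "enat CARD('n) \<le> d + enat (rho inJ c) + 1"
    if "\<forall>\<^sub>F k in sequentially. depth_quot (ideal_pow I k) = d" for d
  proof -
    have "\<forall>\<^sub>F k in sequentially. enat CARD('n) \<le> d + enat (rho inJ c) + 1"
      using ev that by eventually_elim simp
    then show ?thesis by simp
  qed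
  then show ?thesis using a ev by blast
qed

end
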